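(* Let $G$ be an $n$-vertex eulerian graph with $\delta(G_{\mathrm{s}})\ge (4n+2)/5$, where $\delta(G_{\mathrm{s}})$ is the minimum degree of the underlying simple graph of $G$. Let $T$ be an euler circuit in $G$. Then there is a $2$-face-colorable orientable embedding of $G$ with $T$ as the unique face of one color and with exactly one or two faces of the other color, depending on whether $|V(G)|+|E(G)|$ is even or odd, respectively. This embedding has maximum genus among all $2$-face-colorable orientable embeddings of $G$. When $|V(G)|+|E(G)|$ is even, this embedding is an orientable bi-eulerian embedding of $G$ with $T$ as a specified face, and the embedding has maximum genus among all orientable embeddings of $G$.
   Context: Graphs are finite and may have loops and multiple edges. An eulerian graph is a connected graph with every vertex of even degree. $G_{\mathrm{s}}$ is the simple graph on $V(G)$ in which distinct $u,v$ are adjacent if and only if they are joined by an edge of $G$. An euler circuit is a closed walk, considered up to cyclic shift (and, as a facial walk, up to reversal), that uses every edge exactly once and contains every vertex. All embeddings are cellular embeddings in closed surfaces; a face is identified with its facial boundary walk. An embedding is $2$-face-colorable if its faces can be colored with two colors so that each edge has faces of different colors on its two sides. An embedding is bi-eulerian if it has exactly two faces, each bounded by an euler circuit. *)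

theory Defs
  imports
    Complex_Main
    "HOL-Combinatorics.Orbits"
    "Graph_Theory.Bidirected_Digraph"
    "Graph_Theory.Arc_Walk"
    "Graph_Theory.Digraph_Component"
begin

text \<open>
  A finite undirected graph, loops and multiple edges allowed, is given by its darts: every edge
  is a pair of mutually reverse arcs \<open>{a, arev a}\<close>.  A loop consists of two distinct darts
  with the same tail and head, so it contributes 2 to the degree of its vertex, and the
  degree of a vertex is its out-degree.
\<close>

locale multigraph = fin_digraph G + bidirected_digraph G arev
  for G :: "('a, 'b) pre_digraph" and arev :: "'b \<Rightarrow> 'b"

definition edges :: "('a, 'b) pre_digraph \<Rightarrow> ('b \<Rightarrow> 'b) \<Rightarrow> 'b set set" where
  "edges G arev = (\<lambda>a. {a, arev a}) ` arcs G"

definition eulerian :: "('a, 'b) pre_digraph \<Rightarrow> bool" where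
  "eulerian G \<longleftrightarrow> Digraph_Component.connected G \<and> (\<forall>v\<in>verts G. even (out_degree G v))"

definition underlying_simple :: "('a, 'b) pre_digraph \<Rightarrow> ('a, 'a \<times> 'a) pre_digraph" where
  "underlying_simple G =
     \<lparr> verts = verts G, arcs = {(u, v). u \<noteq> v \<and> u \<rightarrow>\<^bsub>G\<^esub> v}, tail = fst, head = snd \<rparr>"

definition min_degree :: "('a, 'b) pre_digraph \<Rightarrow> nat" where
  "min_degree G = Min (out_degree G ` verts G)"

text \<open>
  A closed walk is listed as the sequence of its darts from an arbitrary starting point.
  Each edge is used exactly once, i.e. in exactly one direction and at exactly one position.
\<close>

definition euler_circuit :: "('a, 'b) pre_digraph \<Rightarrow> ('b \<Rightarrow> 'b) \<Rightarrow> 'b list \<Rightarrow> bool" where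
  "euler_circuit G arev p \<longleftrightarrow>
     (\<exists>u. pre_digraph.awalk G u p u \<and> set (pre_digraph.awalk_verts G u p) = verts G) \<and>
     (\<forall>e\<in>edges G arev. \<exists>!i. i < length p \<and> p ! i \<in> e)"

text \<open>
  Cellular embeddings of a connected graph in oriented closed surfaces are represented by rotation
  systems (Heffter--Edmonds): a permutation \<open>rot\<close> of the darts that cyclically permutes the
  darts leaving each vertex.  The face to one side of a dart \<open>a\<close> is traced by following \<open>a\<close> to
  its head and leaving along the successor, in the rotation there, of the reverse of \<open>a\<close>.
  Each dart lies in exactly one face orbit, and the faces on the two sides of an edge
  \<open>{a, arev a}\<close> are the orbits of \<open>a\<close> and of \<open>arev a\<close>.  (Graphs without
  edges have no face orbit; they are not meant to be covered.)
\<close>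

definition orientable_embedding :: "('a, 'b) pre_digraph \<Rightarrow> ('b \<Rightarrow> 'b) \<Rightarrow> bool" where
  "orientable_embedding G rot \<longleftrightarrow>
     rot permutes arcs G \<and>
     (\<forall>v\<in>verts G. out_arcs G v \<noteq> {} \<longrightarrow> cyclic_on rot (out_arcs G v))"

definition face_step :: "('b \<Rightarrow> 'b) \<Rightarrow> ('b \<Rightarrow> 'b) \<Rightarrow> 'b \<Rightarrow> 'b" where
  "face_step arev rot = rot \<circ> arev"

definition face_of :: "('b \<Rightarrow> 'b) \<Rightarrow> ('b \<Rightarrow> 'b) \<Rightarrow> 'b \<Rightarrow> 'b set" where
  "face_of arev rot a = orbit (face_step arev rot) a"

definition faces :: "('a, 'b) pre_digraph \<Rightarrow> ('b \<Rightarrow> 'b) \<Rightarrow> ('b \<Rightarrow> 'b) \<Rightarrow> 'b set set" where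
  "faces G arev rot = face_of arev rot ` arcs G"

definition traces :: "('b \<Rightarrow> 'b) \<Rightarrow> ('b \<Rightarrow> 'b) \<Rightarrow> 'b set \<Rightarrow> 'b list \<Rightarrow> bool" where
  "traces arev rot F p \<longleftrightarrow>
     distinct p \<and> set p = F \<and>
     (\<forall>i<length p. p ! (Suc i mod length p) = face_step arev rot (p ! i))"

text \<open>
  Boundary walks of a face: the starting point is arbitrary, and the boundary may be traversed in
  either direction; \<open>rev (map arev p)\<close> is the walk \<open>p\<close> traversed backwards.
\<close>

definition facial_walk :: "('b \<Rightarrow> 'b) \<Rightarrow> ('b \<Rightarrow> 'b) \<Rightarrow> 'b set \<Rightarrow> 'b list \<Rightarrow> bool" where
  "facial_walk arev rot F p \<longleftrightarrow> traces arev rot F p \<or> traces arev rot F (rev (map arev p))"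

definition proper_2_face_coloring ::
    "('a, 'b) pre_digraph \<Rightarrow> ('b \<Rightarrow> 'b) \<Rightarrow> ('b \<Rightarrow> 'b) \<Rightarrow> ('b set \<Rightarrow> bool) \<Rightarrow> bool" where
  "proper_2_face_coloring G arev rot c \<longleftrightarrow>
     (\<forall>a\<in>arcs G. c (face_of arev rot a) \<noteq> c (face_of arev rot (arev a)))"

definition two_face_colorable ::
    "('a, 'b) pre_digraph \<Rightarrow> ('b \<Rightarrow> 'b) \<Rightarrow> ('b \<Rightarrow> 'b) \<Rightarrow> bool" where
  "two_face_colorable G arev rot \<longleftrightarrow> (\<exists>c. proper_2_face_coloring G arev rot c)"

definition bi_eulerian ::
    "('a, 'b) pre_digraph \<Rightarrow> ('b \<Rightarrow> 'b) \<Rightarrow> ('b \<Rightarrow> 'b) \<Rightarrow> bool" where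
  "bi_eulerian G arev rot \<longleftrightarrow>
     card (faces G arev rot) = 2 \<and>
     (\<forall>F\<in>faces G arev rot. \<exists>p. facial_walk arev rot F p \<and> euler_circuit G arev p)"

definition euler_char ::
    "('a, 'b) pre_digraph \<Rightarrow> ('b \<Rightarrow> 'b) \<Rightarrow> ('b \<Rightarrow> 'b) \<Rightarrow> int" where
  "euler_char G arev rot =
     int (card (verts G)) - int (card (edges G arev)) + int (card (faces G arev rot))"

text \<open>
  The genus \<open>g\<close> of the surface is determined by Euler's formula \<open>\<chi> = 2 - 2 g\<close>
  for connected \<open>G\<close>; it is taken as a real number so that no rounding is involved.
\<close>

definition genus :: "('a, 'b) pre_digraph \<Rightarrow> ('b \<Rightarrow> 'b) \<Rightarrow> ('b \<Rightarrow> 'b) \<Rightarrow> real" where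
  "genus G arev rot = (2 - of_int (euler_char G arev rot)) / 2"

end

theory Submission
  imports Defs
begin

text \<open>
  Orient every edge as \<open>T\<close> traverses it.  If \<open>T\<close> is to be a face and the remaining faces are to
  use the reversed edges only, the rotation at a vertex \<open>v\<close> amounts to a cyclic permutation of the
  passages of \<open>T\<close> through \<open>v\<close>; with \<open>c\<close> the successor along \<open>T\<close> and \<open>\<sigma>\<close> the product of these
  permutations, the remaining faces are the cycles of \<open>c \<circ> \<sigma>\<close>.  So \<open>\<sigma>\<close> has to be chosen such that
  \<open>c \<circ> \<sigma>\<close> has at most two cycles; parity then fixes their number, and parity also bounds the number
  of faces of every competing embedding.

  Choose a maximal set \<open>S\<close> of vertices that can be given their cyclic permutations (the others
  getting the identity) so that \<open>c \<circ> \<sigma>\<close> is one cycle.  A vertex outside \<open>S\<close> has an even number of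
  passages, since an odd class can always be added.  Let \<open>u\<close> and \<open>v\<close> be two such vertices.  They are
  not interlaced on the cycle, and for a third vertex \<open>w\<close> that occurs both in a gap of \<open>u\<close> free of
  \<open>v\<close> and in a gap of \<open>v\<close> free of \<open>u\<close>, all passages lie in these two gaps, because otherwise
  changing the permutation at \<open>w\<close> as well would allow \<open>u\<close> and \<open>v\<close> to be added.  Hence each such
  \<open>w\<close> has a position in a grid (gaps of \<open>u\<close>) \<open>\<times>\<close> (gaps of \<open>v\<close>), vertices differing in both
  coordinates are not adjacent, and at most two neighbours of \<open>u\<close> lie in a row and at most two
  neighbours of \<open>v\<close> in a column.  With \<open>d = n - 1 - \<delta>\<close> the degree condition says \<open>n \<ge> 5 d + 7\<close>,
  so that there are at least \<open>3 d + 3\<close> such neighbours of either kind, and this is impossible.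
\<close>

section \<open>Cycles of a permutation and transpositions\<close>

text \<open>All of a cycle is reached from any of its points, so membership in \<open>S\<close>
  spreads from \<open>x\<close> along \<open>p\<close>. This serves as the induction principle for
  cycles below.\<close>

lemma cyclic_on_subset_of_closed:
  assumes "cyclic_on p A" "x \<in> A" "x \<in> S" "\<And>z. z \<in> A \<Longrightarrow> z \<in> S \<Longrightarrow> p z \<in> S"
  shows "A \<subseteq> S"
proof
  fix y assume "y \<in> A"
  then have "y \<in> orbit p x" using assms by (simp add: orbit_cyclic_eq3)
  then have "y \<in> A \<and> y \<in> S"
    by induct (use assms in \<open>auto intro: cyclic_on_inI\<close>)
  then show "y \<in> S" by simp
qed

lemma cyclic_on_congI:
  assumes "cyclic_on g S" "\<And>s. s \<in> S \<Longrightarrow> f s = g s"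
  shows "cyclic_on f S"
  using cyclic_cong[of S f g] assms by blast

lemma cyclic_on_singleton:
  assumes "p y = y"
  shows "cyclic_on p {y}"
  using assms orbit_eq_singleton_iff[of p y] by (auto simp: cyclic_on_def)

lemma permutes_comp_transpose:
  assumes "p permutes S" "S \<subseteq> U" "x \<in> U" "y \<in> U"
  shows "p \<circ> transpose x y permutes U"
  using permutes_compose[OF permutes_swap_id[OF assms(3,4)] permutes_subset[OF assms(1,2)]] .

lemma cyclic_on_nonempty: "cyclic_on p A \<Longrightarrow> A \<noteq> {}"
  by (simp add: cyclic_on_alldef)

text \<open>For a permutation reachability is symmetric, so it is enough that one point
  \<open>t\<close> is reached from everywhere. That direction suits induction on the distance to
  \<open>t\<close>.\<close>

lemma cyclic_onI_reach:
  assumes p: "permutation p" and t: "t \<in> A"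
    and closed: "\<And>z. z \<in> A \<Longrightarrow> p z \<in> A"
    and reach: "\<And>z. z \<in> A \<Longrightarrow> z \<noteq> t \<Longrightarrow> t \<in> orbit p z"
  shows "cyclic_on p A"
proof (rule cyclic_on_singleI[OF t], intro equalityI subsetI)
  fix z assume "z \<in> A"
  then show "z \<in> orbit p t"
    using reach orbit_swap permutation_self_in_orbit[OF p] by metis
next
  fix z assume "z \<in> orbit p t"
  then show "z \<in> A" by induct (use t closed in auto)
qed

text \<open>The transposition exchanges the successors of \<open>x\<close> and \<open>y\<close>:
  from \<open>x\<close> the walk enters \<open>B\<close> at \<open>p y\<close>, runs through
  \<open>B\<close> until \<open>y\<close>, and then returns to \<open>A\<close> at
  \<open>p x\<close>.\<close>

lemma cyclic_on_merge:
  assumes A: "cyclic_on p A" and B: "cyclic_on p B" and disj: "A \<inter> B = {}"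
    and x: "x \<in> A" and y: "y \<in> B"
  shows "cyclic_on (p \<circ> transpose x y) (A \<union> B)"
proof -
  let ?q = "p \<circ> transpose x y"
  \<comment> \<open>Kept general in \<open>D\<close>, to be applied to \<open>B\<close> seen from
    \<open>x\<close> and to \<open>A\<close> seen from \<open>y\<close>.\<close>
  have half: "D \<subseteq> orbit (p \<circ> transpose a b) a"
    if D: "cyclic_on p D" "b \<in> D" "a \<notin> D" for a b D
  proof -
    have qa: "(p \<circ> transpose a b) a = p b" by simp
    show ?thesis
    proof (rule cyclic_on_subset_of_closed[OF D(1), of "p b"])
      show "p b \<in> D" using D by (simp add: cyclic_on_inI)
      show "p b \<in> orbit (p \<circ> transpose a b) a" using orbit.base[of "p \<circ> transpose a b" a] qa by simp
      fix z assume z: "z \<in> D" "z \<in> orbit (p \<circ> transpose a b) a"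
      show "p z \<in> orbit (p \<circ> transpose a b) a"
      proof (cases "z = b")
        case True
        then show ?thesis using orbit.base[of "p \<circ> transpose a b" a] qa by simp
      next
        case False
        then have "(p \<circ> transpose a b) z = p z" using z D by (auto simp: transpose_def)
        then show ?thesis using orbit.step[OF z(2)] by simp
      qed
    qed
  qed
  have 1: "B \<subseteq> orbit ?q x" using half[OF B y] x disj by blast
  have 2: "A \<subseteq> orbit ?q y"
    using half[OF A x, of y] y disj by (auto simp: transpose_commute)
  have 3: "orbit ?q y \<subseteq> orbit ?q x"
    using 1 y orbit_trans by fast
  have "orbit ?q x \<subseteq> A \<union> B"
  proof
    fix z assume "z \<in> orbit ?q x"
    then show "z \<in> A \<union> B"
      by induct (use A B x y in \<open>auto simp: transpose_def intro: cyclic_on_inI\<close>)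
  qed
  then have "A \<union> B = orbit ?q x" using 1 2 3 by blast
  then show ?thesis using x by (intro cyclic_on_singleI[of x]) auto
qed

lemma cyclic_on_transpose_outside:
  assumes "cyclic_on p C" "x \<notin> C" "y \<notin> C"
  shows "cyclic_on (p \<circ> transpose x y) C"
  using assms(1) by (rule cyclic_on_congI) (use assms in \<open>auto simp: transpose_def\<close>)

lemma cyclic_on_insert_right:
  assumes "cyclic_on p A" "x \<in> A" "y \<notin> A" "p y = y"
  shows "cyclic_on (p \<circ> transpose x y) (insert y A)"
proof -
  have "cyclic_on p {y}"
    using assms(4) by (rule cyclic_on_singleton)
  from cyclic_on_merge[OF assms(1) this] show ?thesis using assms by simp
qed

text \<open>Since \<open>p\<close> fixes \<open>y\<close>, the transposition can be moved to the
  right of \<open>p\<close> if \<open>x\<close> is replaced by its preimage; this reduces the claim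
  to insertion on the right.\<close>

lemma cyclic_on_insert_left:
  assumes p: "p permutes A" "cyclic_on p A" and x: "x \<in> A" and y: "y \<notin> A"
  shows "cyclic_on (transpose x y \<circ> p) (insert y A)"
proof -
  let ?x = "inv p x"
  have b: "bij p" using p(1) by (rule permutes_bij)
  have py: "p y = y" using p y by (simp add: permutes_not_in)
  have px: "p ?x = x" using permutes_inverses(1)[OF p(1)] .
  have "?x \<in> A" using x px permutes_in_image[OF p(1)] by metis
  then have "cyclic_on (p \<circ> transpose ?x y) (insert y A)"
    using cyclic_on_insert_right[OF p(2) _ y py] by simp
  moreover have "p \<circ> transpose ?x y = transpose x y \<circ> p"
  proof
    fix z
    have "p z = x \<longleftrightarrow> z = ?x" "p z = y \<longleftrightarrow> z = y"
      using px py b by (metis bij_def injD)+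
    then show "(p \<circ> transpose ?x y) z = (transpose x y \<circ> p) z"
      using px py by (auto simp: transpose_def)
  qed
  ultimately show ?thesis by simp
qed

text \<open>On a cycle the fibres of \<open>first_hit p K\<close> are the gaps between consecutive
  elements of \<open>K\<close>, each containing, and named by, the element that ends it. The value
  is meaningful only if \<open>K\<close> is reached from \<open>z\<close>.\<close>

definition first_hit :: "('b \<Rightarrow> 'b) \<Rightarrow> 'b set \<Rightarrow> 'b \<Rightarrow> 'b" where
  "first_hit p K z = (p ^^ (LEAST n. (p ^^ n) z \<in> K)) z"

lemma first_hit_self: "z \<in> K \<Longrightarrow> first_hit p K z = z"
proof -
  assume "z \<in> K"
  then have "(LEAST n. (p ^^ n) z \<in> K) = 0" by (intro Least_eq_0) simp
  then show ?thesis by (simp add: first_hit_def)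
qed

lemma cyclic_on_reaches:
  assumes "cyclic_on p A" "K \<inter> A \<noteq> {}" "z \<in> A"
  shows "\<exists>n. (p ^^ n) z \<in> K"
proof -
  obtain k where k: "k \<in> K" "k \<in> A" using assms by blast
  then have "k \<in> orbit p z" using assms by (simp add: orbit_cyclic_eq3)
  then show ?thesis using k by (auto simp: orbit_altdef)
qed

lemma first_hit_in:
  assumes "cyclic_on p A" "K \<inter> A \<noteq> {}" "z \<in> A"
  shows "first_hit p K z \<in> K \<inter> A"
proof -
  have "(p ^^ (LEAST n. (p ^^ n) z \<in> K)) z \<in> K"
    using cyclic_on_reaches[OF assms] by (rule LeastI_ex)
  then show ?thesis using cyclic_on_funpow_in[OF assms(1,3)] by (auto simp: first_hit_def)
qed

lemma first_hit_step:
  assumes "cyclic_on p A" "K \<inter> A \<noteq> {}" "z \<in> A" "z \<notin> K"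
  shows "first_hit p K (p z) = first_hit p K z"
proof -
  obtain n where n: "(p ^^ n) z \<in> K" using cyclic_on_reaches[OF assms(1-3)] by blast
  have "(LEAST n. (p ^^ n) z \<in> K) = Suc (LEAST m. (p ^^ Suc m) z \<in> K)"
    using n by (rule Least_Suc) (use assms in simp)
  then show ?thesis by (simp add: first_hit_def funpow_swap1)
qed

text \<open>Induction on a number of steps after which \<open>K\<close> is met; a property is
  carried backwards from the end of a gap.\<close>

lemma first_hit_induct [consumes 3, case_names base step]:
  assumes "cyclic_on p A" "K \<inter> A \<noteq> {}" "z \<in> A"
    and base: "\<And>z. z \<in> A \<Longrightarrow> z \<in> K \<Longrightarrow> P z"
    and step: "\<And>z. z \<in> A \<Longrightarrow> z \<notin> K \<Longrightarrow> P (p z) \<Longrightarrow> P z"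
  shows "P z"
proof -
  obtain n where "(p ^^ n) z \<in> K" using cyclic_on_reaches[OF assms(1-3)] by blast
  then show ?thesis using \<open>z \<in> A\<close>
  proof (induct n arbitrary: z)
    case 0
    then show ?case using base by simp
  next
    case (Suc n)
    have "P (p z)"
      using Suc.hyps[of "p z"] Suc.prems cyclic_on_inI[OF assms(1)] by (simp add: funpow_swap1)
    then show ?case using base step Suc.prems by blast
  qed
qed

text \<open>Otherwise the elements whose first hit differs from \<open>t\<close> would be closed
  under \<open>p\<close> and fill the whole cycle, although \<open>t\<close> hits itself.\<close>

lemma first_hit_return_surj:
  assumes p: "cyclic_on p A" and t: "t \<in> K" "K \<subseteq> A"
  shows "\<exists>s\<in>K. first_hit p K (p s) = t"
proof (rule ccontr)
  assume none: "\<not> (\<exists>s\<in>K. first_hit p K (p s) = t)"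
  have ne: "K \<inter> A \<noteq> {}" and tA: "t \<in> A" using t by auto
  have "A \<subseteq> {z \<in> A. first_hit p K z \<noteq> t}"
  proof (rule cyclic_on_subset_of_closed[OF p, of "p t"])
    show "p t \<in> A" using p tA by (rule cyclic_on_inI)
    then show "p t \<in> {z \<in> A. first_hit p K z \<noteq> t}" using none t by auto
    fix z assume "z \<in> A" "z \<in> {z \<in> A. first_hit p K z \<noteq> t}"
    then show "p z \<in> {z \<in> A. first_hit p K z \<noteq> t}"
      using none first_hit_step[OF p ne] cyclic_on_inI[OF p] by (cases "z \<in> K") auto
  qed
  then show False using tA first_hit_self[of t K p] t by auto
qed

text \<open>The return map sends the finite set \<open>K\<close> onto itself. Injectivity means that
  only one element of \<open>K\<close> leads into a given gap.\<close>

lemma first_hit_return_inj: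
  assumes p: "cyclic_on p A" and K: "K \<subseteq> A"
  shows "inj_on (\<lambda>s. first_hit p K (p s)) K"
proof (cases "K = {}")
  case False
  have "finite K" using finite_cyclic_on[OF p] K by (rule rev_finite_subset)
  moreover have "K \<subseteq> (\<lambda>s. first_hit p K (p s)) ` K"
    using first_hit_return_surj[OF p _ K] by blast
  moreover have "(\<lambda>s. first_hit p K (p s)) ` K \<subseteq> K"
    using first_hit_in[OF p] False K cyclic_on_inI[OF p] by blast
  ultimately show ?thesis by (metis (no_types, lifting) eq_card_imp_inj_on subset_antisym)
qed simp

text \<open>Here \<open>s\<close> is the element of \<open>K\<close> before \<open>t\<close>. After
  the transposition \<open>t\<close> is followed by \<open>p s\<close>, the start of the gap ending
  at \<open>t\<close>, which thus closes up; \<open>s\<close> is followed by \<open>p t\<close> and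
  skips that gap.\<close>

lemma cyclic_on_split:
  assumes p: "permutation p" "cyclic_on p A" and K: "K \<subseteq> A" "s \<in> K" "t \<in> K"
    and st: "s \<noteq> t" "first_hit p K (p s) = t"
  shows "cyclic_on (p \<circ> transpose s t) {z \<in> A. first_hit p K z = t}"
    and "cyclic_on (p \<circ> transpose s t) {z \<in> A. first_hit p K z \<noteq> t}"
proof -
  let ?q = "p \<circ> transpose s t"
  have q: "permutation ?q" using p(1) by (simp add: permutation_compose permutation_swap_id)
  have ne: "K \<inter> A \<noteq> {}" and A: "s \<in> A" "t \<in> A" using K by auto
  note inA = cyclic_on_inI[OF p(2)]
  note step = first_hit_step[OF p(2) ne]
  have other: "first_hit p K (p z) \<noteq> t" if "z \<in> K" "z \<noteq> s" for z
    using first_hit_return_inj[OF p(2) K(1)] that K st by (metis inj_onD)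
  show "cyclic_on ?q {z \<in> A. first_hit p K z = t}"
  proof (rule cyclic_onI_reach[OF q, of t])
    show "t \<in> {z \<in> A. first_hit p K z = t}" using K A by (simp add: first_hit_self)
    have qz: "?q z = p z" if "z \<in> A" "first_hit p K z = t" "z \<noteq> t" for z
      using that K st by (auto simp: transpose_def first_hit_self)
    show closed: "?q z \<in> {z \<in> A. first_hit p K z = t}"
      if "z \<in> {z \<in> A. first_hit p K z = t}" for z
    proof (cases "z = t")
      case True
      then show ?thesis using st A inA by simp
    next
      case False
      then have "z \<notin> K" using that first_hit_self by fastforce
      then show ?thesis using qz[of z] False that step inA by simp
    qed
    fix z assume z: "z \<in> {z \<in> A. first_hit p K z = t}" "z \<noteq> t"
    have "z \<in> A" using z by simp
    have "{t} \<inter> A \<noteq> {}" using A by blast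
    from p(2) this \<open>z \<in> A\<close>
    have "z \<in> A \<longrightarrow> first_hit p K z = t \<longrightarrow> z \<noteq> t \<longrightarrow> t \<in> orbit ?q z"
    proof (induct rule: first_hit_induct)
      case (step z)
      show ?case
      proof (intro impI)
        assume h: "z \<in> A" "first_hit p K z = t" "z \<noteq> t"
        have e: "?q z = p z" using qz h by simp
        have "p z \<in> A" "first_hit p K (p z) = t" using closed[of z] h e by auto
        then have "p z = t \<or> t \<in> orbit ?q (?q z)" using step(3) unfolding e by blast
        then show "t \<in> orbit ?q z" using e orbit.base[of ?q z] orbit_subset[of t ?q z] by auto
      qed
    qed auto
    then show "t \<in> orbit ?q z" using z by simp
  qed
  show "cyclic_on ?q {z \<in> A. first_hit p K z \<noteq> t}"
  proof (rule cyclic_onI_reach[OF q, of s])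
    show "s \<in> {z \<in> A. first_hit p K z \<noteq> t}" using K A st by (simp add: first_hit_self)
    have qz: "?q z = p z" if "z \<in> A" "first_hit p K z \<noteq> t" "z \<noteq> s" for z
      using that K by (auto simp: transpose_def first_hit_self)
    show closed: "?q z \<in> {z \<in> A. first_hit p K z \<noteq> t}"
      if "z \<in> {z \<in> A. first_hit p K z \<noteq> t}" for z
    proof (cases "z = s")
      case True
      then show ?thesis using other[of t] K st A inA by simp
    next
      case False
      then show ?thesis using qz[of z] that step[of z] other[of z] inA by (cases "z \<in> K") auto
    qed
    fix z assume z: "z \<in> {z \<in> A. first_hit p K z \<noteq> t}" "z \<noteq> s"
    have "z \<in> A" using z by simp
    have "{s} \<inter> A \<noteq> {}" using A by blast
    from p(2) this \<open>z \<in> A\<close>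
    have "z \<in> A \<longrightarrow> first_hit p K z \<noteq> t \<longrightarrow> z \<noteq> s \<longrightarrow> s \<in> orbit ?q z"
    proof (induct rule: first_hit_induct)
      case (step z)
      show ?case
      proof (intro impI)
        assume h: "z \<in> A" "first_hit p K z \<noteq> t" "z \<noteq> s"
        have e: "?q z = p z" using qz h by simp
        have "p z \<in> A" "first_hit p K (p z) \<noteq> t" using closed[of z] h e by auto
        then have "p z = s \<or> s \<in> orbit ?q (?q z)" using step(3) unfolding e by blast
        then show "s \<in> orbit ?q z" using e orbit.base[of ?q z] orbit_subset[of s ?q z] by auto
      qed
    qed auto
    then show "s \<in> orbit ?q z" using z by simp
  qed
qed

text \<open>If \<open>t\<close> returned to itself first, its gap would be closed under
  \<open>p\<close> and hence be the whole cycle, but \<open>t'\<close> lies outside it.\<close>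

lemma first_hit_return_neq:
  assumes p: "cyclic_on p A" and K: "K \<subseteq> A" "t \<in> K" "t' \<in> K" "t' \<noteq> t"
  shows "first_hit p K (p t) \<noteq> t"
proof
  assume ret: "first_hit p K (p t) = t"
  have ne: "K \<inter> A \<noteq> {}" using K by auto
  have "A \<subseteq> {z. first_hit p K z = t}"
  proof (rule cyclic_on_subset_of_closed[OF p, of t])
    show "t \<in> {z. first_hit p K z = t}" using K by (simp add: first_hit_self)
    fix z assume "z \<in> A" "z \<in> {z. first_hit p K z = t}"
    then show "p z \<in> {z. first_hit p K z = t}"
      using ret first_hit_step[OF p ne, of z] by (cases "z \<in> K") (auto simp: first_hit_self)
  qed (use K in auto)
  then show False using K by (auto simp: first_hit_self)
qed

lemma cyclic_on_split_gap:
  assumes p: "permutation p" "cyclic_on p A" and K: "K \<subseteq> A" "t \<in> K" "t' \<in> K" "t' \<noteq> t"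
  obtains s where "s \<in> K" "s \<noteq> t" "first_hit p K (p s) = t"
    "cyclic_on (p \<circ> transpose s t) {z \<in> A. first_hit p K z = t}"
    "cyclic_on (p \<circ> transpose s t) {z \<in> A. first_hit p K z \<noteq> t}"
proof -
  obtain s where s: "s \<in> K" "first_hit p K (p s) = t"
    using first_hit_return_surj[OF p(2) K(2,1)] by blast
  have "s \<noteq> t" using first_hit_return_neq[OF p(2) K] s by blast
  then show ?thesis using that s cyclic_on_split[OF p K(1) s(1) K(2) _ s(2)] by blast
qed

lemma first_hit_pair:
  assumes p: "cyclic_on p A" and xy: "x \<in> A" "y \<in> A" "x \<noteq> y"
  shows "first_hit p {x, y} (p x) = y"
  using first_hit_return_neq[OF p, of "{x, y}" x y] first_hit_in[OF p, of "{x, y}" "p x"]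
    cyclic_on_inI[OF p] xy by auto

lemma cyclic_on_split_pair:
  assumes p: "permutation p" "cyclic_on p A" and xy: "x \<in> A" "y \<in> A" "x \<noteq> y"
  obtains B C where "B \<inter> C = {}" "B \<union> C = A" "x \<in> B" "y \<in> C"
    "cyclic_on (p \<circ> transpose x y) B" "cyclic_on (p \<circ> transpose x y) C"
proof
  let ?B = "{z \<in> A. first_hit p {x, y} z \<noteq> y}" and ?C = "{z \<in> A. first_hit p {x, y} z = y}"
  show "?B \<inter> ?C = {}" "?B \<union> ?C = A" by auto
  show "x \<in> ?B" "y \<in> ?C" using xy by (auto simp: first_hit_self)
  show "cyclic_on (p \<circ> transpose x y) ?B" "cyclic_on (p \<circ> transpose x y) ?C"
    using cyclic_on_split[OF p, of "{x, y}" x y] xy first_hit_pair[OF p(2) xy] by auto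
qed

text \<open>The walk from \<open>z\<close> to the end \<open>t\<close> of its gap meets no element
  of \<open>L\<close>.\<close>

lemma first_hit_const_on_gap:
  assumes p: "cyclic_on p A" and K: "K \<subseteq> A" and L: "L \<inter> A \<noteq> {}"
    and disj: "L \<inter> {z \<in> A. first_hit p K z = t} = {}"
    and z: "z \<in> A" "first_hit p K z = t" and t: "t \<in> K"
  shows "first_hit p L z = first_hit p L t"
proof -
  have ne: "K \<inter> A \<noteq> {}" using K t by auto
  from p ne z(1) have "first_hit p K z = t \<longrightarrow> first_hit p L z = first_hit p L t"
  proof (induct rule: first_hit_induct)
    case (base z)
    then show ?case by (simp add: first_hit_self)
  next
    case (step z)
    show ?case
    proof
      assume zt: "first_hit p K z = t"
      then have "z \<notin> L" using disj step by blast
      then show "first_hit p L z = first_hit p L t"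
        using zt step first_hit_step[OF p ne, of z] first_hit_step[OF p L, of z] by simp
    qed
  qed
  then show ?thesis using z by simp
qed

text \<open>Both arcs between \<open>x\<close> and \<open>y\<close> meet \<open>L\<close>, because
  the ends of an arc free of \<open>L\<close> would have the same first hit.\<close>

lemma cyclic_on_split_interlaced:
  assumes p: "permutation p" "cyclic_on p A" and xy: "x \<in> A" "y \<in> A" "x \<notin> L" "y \<notin> L"
    and L: "L \<subseteq> A" "L \<noteq> {}" and sep: "first_hit p L x \<noteq> first_hit p L y"
  obtains B C where "B \<inter> C = {}" "B \<union> C = A" "x \<in> B" "y \<in> C" "L \<inter> B \<noteq> {}" "L \<inter> C \<noteq> {}"
    "cyclic_on (p \<circ> transpose x y) B" "cyclic_on (p \<circ> transpose x y) C"
proof -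
  have neq: "x \<noteq> y" using sep by auto
  have LA: "L \<inter> A \<noteq> {}" using L by auto
  have meets: "L \<inter> {z \<in> A. first_hit p {a, b} z = b} \<noteq> {}"
    if ab: "a \<in> A" "b \<in> A" "a \<noteq> b" "a \<notin> L" "first_hit p L a \<noteq> first_hit p L b" for a b
  proof
    assume *: "L \<inter> {z \<in> A. first_hit p {a, b} z = b} = {}"
    have "first_hit p L (p a) = first_hit p L b"
      by (rule first_hit_const_on_gap[OF p(2) _ LA *])
        (use ab first_hit_pair[OF p(2) ab(1-3)] cyclic_on_inI[OF p(2)] in auto)
    then show False using first_hit_step[OF p(2) LA ab(1,4)] ab(5) by simp
  qed
  let ?B = "{z \<in> A. first_hit p {x, y} z \<noteq> y}" and ?C = "{z \<in> A. first_hit p {x, y} z = y}"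
  \<comment> \<open>The arc ending at \<open>x\<close>, rewritten with \<open>x\<close> and
    \<open>y\<close> exchanged, so that \<open>meets\<close> covers both arcs.\<close>
  have B: "?B = {z \<in> A. first_hit p {y, x} z = x}"
    using first_hit_in[OF p(2), of "{x, y}"] xy neq by (auto simp: insert_commute)
  show ?thesis
  proof
    show "?B \<inter> ?C = {}" "?B \<union> ?C = A" by auto
    show "x \<in> ?B" "y \<in> ?C" using xy neq by (auto simp: first_hit_self)
    show "cyclic_on (p \<circ> transpose x y) ?B" "cyclic_on (p \<circ> transpose x y) ?C"
      using cyclic_on_split[OF p, of "{x, y}" x y] xy neq first_hit_pair[OF p(2) xy(1,2) neq] by auto
    show "L \<inter> ?B \<noteq> {}" unfolding B using meets[of y x] xy neq sep by auto
    show "L \<inter> ?C \<noteq> {}" using meets[of x y] xy neq sep by auto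
  qed
qed

text \<open>Only the step from \<open>s\<close> matters: it now leads to \<open>p t\<close> instead
  of \<open>p s\<close>. From \<open>p s\<close> the walk would have crossed the removed gap, which
  contains no element of \<open>L\<close>, and then continued from \<open>p t\<close> as
  well.\<close>

lemma first_hit_split_gap:
  assumes p: "permutation p" "cyclic_on p A" and K: "K \<subseteq> A" "s \<in> K" "t \<in> K"
    and st: "s \<noteq> t" "first_hit p K (p s) = t"
    and L: "L \<subseteq> {z \<in> A. first_hit p K z \<noteq> t}" "L \<noteq> {}" "L \<inter> K = {}"
    and z: "z \<in> A" "first_hit p K z \<noteq> t"
  shows "first_hit (p \<circ> transpose s t) L z = first_hit p L z"
proof -
  let ?q = "p \<circ> transpose s t" and ?A = "{z \<in> A. first_hit p K z \<noteq> t}"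
  have q: "cyclic_on ?q ?A" using cyclic_on_split(2)[OF p K st] .
  have LA: "L \<inter> ?A \<noteq> {}" and LA': "L \<inter> A \<noteq> {}" using L by auto
  have disj: "L \<inter> {z \<in> A. first_hit p K z = t} = {}" using L by auto
  have "z \<in> ?A" using z by simp
  from q LA this show ?thesis
  proof (induct rule: first_hit_induct)
    case (base z)
    then show ?case by (simp add: first_hit_self)
  next
    case (step z)
    have "first_hit p L (?q z) = first_hit p L z"
    proof (cases "z = s")
      case True
      have "first_hit p L (p s) = first_hit p L t"
        using st K cyclic_on_inI[OF p(2)] by (intro first_hit_const_on_gap[OF p(2) K(1) LA' disj]) auto
      moreover have "t \<notin> L" "s \<notin> L" "t \<in> A" "s \<in> A" using L K by auto
      ultimately show ?thesis
        using True K first_hit_step[OF p(2) LA', of t] first_hit_step[OF p(2) LA', of s] by auto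
    next
      case False
      moreover have "z \<noteq> t" using step K by (auto simp: first_hit_self)
      ultimately have "?q z = p z" by (simp add: transpose_def)
      then show ?thesis using step first_hit_step[OF p(2) LA', of z] by simp
    qed
    then show ?case using step(3) first_hit_step[OF q LA step(1,2)] by (simp only:)
  qed
qed

text \<open>The class is enlarged by two elements at a time; of the two possible ways to split by one
  transposition and merge by another, the position of the second new element selects one.\<close>

lemma odd_cycle_preserves_cyclic:
  assumes "p permutes X" "finite X" "cyclic_on p X" "J \<subseteq> X" "odd (card J)"
  shows "\<exists>\<rho>. \<rho> permutes J \<and> cyclic_on \<rho> J \<and> cyclic_on (p \<circ> \<rho>) X"
proof -
  have "finite J" using assms by (auto intro: finite_subset)
  from assms(4,5) obtain m where "card J = Suc (2 * m)" by (elim oddE) auto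
  with \<open>finite J\<close> \<open>J \<subseteq> X\<close> show ?thesis
  proof (induct m arbitrary: J)
    case 0
    then obtain x where J: "J = {x}" by (metis card_1_singletonE mult_0_right One_nat_def)
    have "id permutes J" "cyclic_on id J" "cyclic_on (p \<circ> id) X"
      using J assms by (simp_all add: cyclic_on_singleton)
    then show ?case by blast
  next
    case (Suc m)
    obtain y J1 where y: "J = insert y J1" "y \<notin> J1" "card J1 = Suc (Suc (2 * m))"
      using Suc.prems(3) by (auto simp only: card_Suc_eq[of J] mult_Suc_right add_2_eq_Suc)
    obtain z J2 where z: "J1 = insert z J2" "z \<notin> J2" "card J2 = Suc (2 * m)"
      using y(3) by (auto simp only: card_Suc_eq[of J1])
    obtain x where x: "x \<in> J2" using z(3) by (auto simp only: card_Suc_eq[of J2])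
    have "finite J2" "J2 \<subseteq> X" using Suc.prems y z by auto
    from Suc.hyps[OF this z(3)] obtain \<rho>
      where r: "\<rho> permutes J2" "cyclic_on \<rho> J2" "cyclic_on (p \<circ> \<rho>) X"
      by blast
    let ?q = "p \<circ> \<rho>"
    have sub: "x \<in> X" "y \<in> X" "z \<in> X" and neq: "x \<noteq> y" "x \<noteq> z" "y \<noteq> z"
      using Suc.prems y z x by auto
    have q: "permutation ?q"
      using permutes_imp_permutation[OF assms(2,1)] permutes_imp_permutation[OF \<open>finite J2\<close> r(1)]
      by (rule permutation_compose)
    obtain B C where BC: "B \<inter> C = {}" "B \<union> C = X" "x \<in> B" "y \<in> C"
      "cyclic_on (?q \<circ> transpose x y) B" "cyclic_on (?q \<circ> transpose x y) C"
      using cyclic_on_split_pair[OF q r(3) sub(1,2) neq(1)] .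
    let ?r = "\<rho> \<circ> transpose x y"
    have r1: "cyclic_on ?r (insert y J2)"
      by (rule cyclic_on_insert_right) (use r x y z in \<open>auto simp: permutes_not_in\<close>)
    have rz: "?r z = z" using z y r neq by (simp add: permutes_not_in)
    have r1p: "?r permutes insert y J2"
      using r(1) by (rule permutes_comp_transpose) (use x in auto)
    \<comment> \<open>Both \<open>x\<close> and \<open>y\<close> lie on the cycle of
      \<open>?r\<close>, so attaching \<open>z\<close> at either one gives a cyclic permutation of
      \<open>J\<close>. The choice of \<open>w\<close> remains free for restoring the cycle on
      \<open>X\<close>.\<close>
    have ext: ?case if w: "w \<in> {x, y}" and c: "cyclic_on (?q \<circ> transpose x y \<circ> transpose w z) X" for w
    proof (intro exI conjI)
      have J: "J = insert z (insert y J2)" using y z by auto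
      show "?r \<circ> transpose w z permutes J"
        using r1p by (rule permutes_comp_transpose) (use w x J in auto)
      show "cyclic_on (?r \<circ> transpose w z) J"
        unfolding J by (rule cyclic_on_insert_right[OF r1]) (use w x y z rz in auto)
      show "cyclic_on (p \<circ> (?r \<circ> transpose w z)) X" using c by (simp add: comp_assoc)
    qed
    show ?case
    \<comment> \<open>\<open>z\<close> is attached to that one of \<open>x\<close>, \<open>y\<close>
      whose cycle does not contain \<open>z\<close>, so that the two cycles merge.\<close>
    proof (cases "z \<in> B")
      case True
      have "cyclic_on (?q \<circ> transpose x y \<circ> transpose y z) (C \<union> B)"
        by (rule cyclic_on_merge) (use BC True in auto)
      then show ?thesis using ext[of y] BC by (simp add: Un_commute)
    next
      case False
      then have "z \<in> C" using BC sub by auto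
      have "cyclic_on (?q \<circ> transpose x y \<circ> transpose x z) (B \<union> C)"
        by (rule cyclic_on_merge) (use BC \<open>z \<in> C\<close> in auto)
      then show ?thesis using ext[of x] BC by simp
    qed
  qed
qed

section \<open>Cyclic words and their occurrences\<close>

locale cyclic_word =
  fixes X :: "'b set" and c :: "'b \<Rightarrow> 'b" and cl :: "'b \<Rightarrow> 'a"
  assumes finite_X: "finite X" and c_permutes: "c permutes X" and c_cyclic: "cyclic_on c X"
begin

definition occ :: "'a \<Rightarrow> 'b set" where
  "occ v = {a \<in> X. cl a = v}"

text \<open>Unresolved classes are fixed pointwise, so that composing with a permutation of such a
  class resolves it without disturbing the others.\<close>

definition resolves :: "'a set \<Rightarrow> ('b \<Rightarrow> 'b) \<Rightarrow> bool" where
  "resolves S \<sigma> \<longleftrightarrow> \<sigma> permutes X \<and> (\<forall>v\<in>S. cyclic_on \<sigma> (occ v)) \<and>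
     (\<forall>a\<in>X. cl a \<notin> S \<longrightarrow> \<sigma> a = a) \<and> cyclic_on (c \<circ> \<sigma>) X"

lemma occ_subset: "occ v \<subseteq> X" and finite_occ: "finite (occ v)"
  using finite_X by (auto simp: occ_def)

lemma occ_disjoint: "u \<noteq> v \<Longrightarrow> occ u \<inter> occ v = {}"
  by (auto simp: occ_def)

lemma resolves_empty: "resolves {} id"
  using c_cyclic by (simp add: resolves_def permutes_id)

lemma resolves_class:
  assumes "resolves S \<sigma>" "a \<in> X"
  shows "\<sigma> a \<in> X" "cl (\<sigma> a) = cl a"
proof -
  show "\<sigma> a \<in> X" using assms by (simp add: resolves_def permutes_in_image)
  show "cl (\<sigma> a) = cl a"
  proof (cases "cl a \<in> S")
    case True
    then have "\<sigma> a \<in> occ (cl a)"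
      using assms cyclic_on_inI[of \<sigma> "occ (cl a)" a] by (simp add: resolves_def occ_def)
    then show ?thesis by (simp add: occ_def)
  next
    case False
    then show ?thesis using assms by (simp add: resolves_def)
  qed
qed

lemma resolves_step_permutes:
  assumes "resolves S \<sigma>"
  shows "c \<circ> \<sigma> permutes X"
  using assms c_permutes by (intro permutes_compose) (simp_all add: resolves_def)

lemma resolves_step_permutation: "resolves S \<sigma> \<Longrightarrow> permutation (c \<circ> \<sigma>)"
  using permutes_imp_permutation[OF finite_X resolves_step_permutes] .

text \<open>As \<open>\<sigma>\<close> is the identity on the class of \<open>v\<close>,
  \<open>\<sigma> \<circ> \<rho>\<close> acts there as the cyclic permutation \<open>\<rho>\<close>;
  on every other class it acts as \<open>\<sigma>\<close>.\<close>

lemma resolve_odd: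
  assumes r: "resolves S \<sigma>" and v: "v \<notin> S" "odd (card (occ v))"
  shows "\<exists>\<sigma>'. resolves (insert v S) \<sigma>'"
proof -
  obtain \<rho> where \<rho>: "\<rho> permutes occ v" "cyclic_on \<rho> (occ v)" "cyclic_on (c \<circ> \<sigma> \<circ> \<rho>) X"
    using odd_cycle_preserves_cyclic[OF resolves_step_permutes[OF r] finite_X _ occ_subset v(2)] r
    by (auto simp: resolves_def)
  have id: "\<rho> a = a" if "a \<in> X" "cl a \<noteq> v" for a
    using \<rho>(1) that by (auto simp: permutes_not_in occ_def)
  have "resolves (insert v S) (\<sigma> \<circ> \<rho>)"
    unfolding resolves_def
  proof (intro conjI ballI impI)
    show "\<sigma> \<circ> \<rho> permutes X"
      using r permutes_subset[OF \<rho>(1) occ_subset] by (intro permutes_compose) (simp_all add: resolves_def)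
    show "cyclic_on (c \<circ> (\<sigma> \<circ> \<rho>)) X" using \<rho>(3) by (simp add: comp_assoc)
    show "(\<sigma> \<circ> \<rho>) a = a" if "a \<in> X" "cl a \<notin> insert v S" for a
      using id that r by (auto simp: resolves_def)
    fix w assume w: "w \<in> insert v S"
    show "cyclic_on (\<sigma> \<circ> \<rho>) (occ w)"
    proof (cases "w = v")
      case True
      have "(\<sigma> \<circ> \<rho>) a = \<rho> a" if "a \<in> occ v" for a
      proof -
        have "\<rho> a \<in> occ v" using that \<rho>(1) by (simp add: permutes_in_image)
        then show ?thesis using r v by (auto simp: resolves_def occ_def)
      qed
      then show ?thesis unfolding True by (rule cyclic_on_congI[OF \<rho>(2)])
    next
      case False
      then have "(\<sigma> \<circ> \<rho>) a = \<sigma> a" if "a \<in> occ w" for a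
        using id that by (auto simp: occ_def)
      then show ?thesis
        using r w False cyclic_on_congI[of \<sigma> "occ w" "\<sigma> \<circ> \<rho>"] by (auto simp: resolves_def)
    qed
  qed
  then show ?thesis by blast
qed

text \<open>Once the transpositions inside two even classes have been placed so that a single cycle
  remains, each of these classes is completed by a cyclic permutation of the odd number of its
  remaining elements.\<close>

lemma resolve_even_pair:
  assumes r: "resolves S \<sigma>" and uv: "u \<noteq> v" "u \<notin> S" "v \<notin> S"
    and even: "even (card (occ u))" "even (card (occ v))"
    and \<tau>: "\<tau> permutes X" "\<And>a. a \<in> X \<Longrightarrow> cl (\<tau> a) = cl a" "\<And>a. a \<in> X \<Longrightarrow> cl a \<notin> S \<Longrightarrow> \<tau> a = a"
      "\<And>w. w \<in> S \<Longrightarrow> cyclic_on (\<sigma> \<circ> \<tau>) (occ w)"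
    and st: "s \<in> occ u" "t \<in> occ u" "s \<noteq> t" and ab: "a \<in> occ v" "b \<in> occ v" "a \<noteq> b"
    and single: "cyclic_on (c \<circ> \<sigma> \<circ> transpose s t \<circ> \<tau> \<circ> transpose a b) X"
  shows "\<exists>\<sigma>'. resolves (insert u (insert v S)) \<sigma>'"
proof -
  let ?\<sigma> = "\<sigma> \<circ> transpose s t \<circ> \<tau> \<circ> transpose a b"
  have inX: "s \<in> X" "t \<in> X" "a \<in> X" "b \<in> X"
    and cls: "cl s = u" "cl t = u" "cl a = v" "cl b = v"
    using st ab by (auto simp: occ_def)
  have \<sigma>: "\<sigma> permutes X" using r by (simp add: resolves_def)
  have \<sigma>p: "?\<sigma> permutes X"
    using \<sigma> \<tau>(1) inX by (intro permutes_compose permutes_swap_id)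
  \<comment> \<open>One end of each transposition is set aside, which leaves classes of odd
    size.\<close>
  have odd: "odd (card (occ u - {t}))" "odd (card (occ v - {b}))"
    using even st ab finite_occ card_Diff_singleton by fastforce+
  have pp: "c \<circ> ?\<sigma> permutes X" using \<sigma>p c_permutes by (rule permutes_compose)
  obtain \<rho>1 where \<rho>1: "\<rho>1 permutes occ u - {t}" "cyclic_on \<rho>1 (occ u - {t})" "cyclic_on (c \<circ> ?\<sigma> \<circ> \<rho>1) X"
    using odd_cycle_preserves_cyclic[OF pp finite_X _ _ odd(1)] single occ_subset
    by (auto simp: comp_assoc)
  have \<rho>1X: "\<rho>1 permutes X" using \<rho>1(1) by (rule permutes_subset) (use occ_subset in auto)
  have pp1: "c \<circ> ?\<sigma> \<circ> \<rho>1 permutes X" using \<rho>1X pp by (rule permutes_compose)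
  obtain \<rho>2 where \<rho>2: "\<rho>2 permutes occ v - {b}" "cyclic_on \<rho>2 (occ v - {b})"
      "cyclic_on (c \<circ> ?\<sigma> \<circ> \<rho>1 \<circ> \<rho>2) X"
    using odd_cycle_preserves_cyclic[OF pp1 finite_X \<rho>1(3) _ odd(2)] occ_subset by blast
  have \<rho>2X: "\<rho>2 permutes X" using \<rho>2(1) by (rule permutes_subset) (use occ_subset in auto)
  have id: "\<rho>1 z = z" if "cl z \<noteq> u" for z
    using \<rho>1(1) that by (auto simp: permutes_not_in occ_def)
  have id2: "\<rho>2 z = z" if "cl z \<noteq> v" for z
    using \<rho>2(1) that by (auto simp: permutes_not_in occ_def)
  have cl1: "\<rho>1 z \<in> occ u" if "z \<in> occ u" for z
    using permutes_not_in[OF \<rho>1(1), of t] permutes_in_image[OF \<rho>1(1), of z] that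
    by (cases "z = t") auto
  have cl2: "\<rho>2 z \<in> occ v" if "z \<in> occ v" for z
    using permutes_not_in[OF \<rho>2(1), of b] permutes_in_image[OF \<rho>2(1), of z] that
    by (cases "z = b") auto
  have tr: "transpose s t z = z" if "cl z \<noteq> u" for z
    using that cls by (auto simp: transpose_def)
  have tr2: "transpose a b z = z" if "cl z \<noteq> v" for z
    using that cls by (auto simp: transpose_def)
  have fix\<sigma>: "\<sigma> z = z" if "z \<in> X" "cl z \<notin> S" for z
    using r that by (simp add: resolves_def)
  have trX: "transpose s t z \<in> occ u" if "z \<in> occ u" for z
    using that st by (auto simp: transpose_def)
  have tr2X: "transpose a b z \<in> occ v" if "z \<in> occ v" for z
    using that ab by (auto simp: transpose_def)
  let ?\<sigma>' = "?\<sigma> \<circ> \<rho>1 \<circ> \<rho>2"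
  have off: "?\<sigma>' z = \<sigma> (\<tau> z)" if "z \<in> X" "cl z \<noteq> u" "cl z \<noteq> v" for z
    using that id id2 tr tr2 \<tau>(2) by simp
  \<comment> \<open>The other factors act trivially on this class. What remains is a cycle on all
    elements but \<open>t\<close>, into which the transposition on its left inserts
    \<open>t\<close>.\<close>
  have on_u: "?\<sigma>' z = (transpose s t \<circ> \<rho>1) z" if z: "z \<in> occ u" for z
  proof -
    have "\<rho>1 z \<in> occ u" "transpose s t (\<rho>1 z) \<in> occ u" using cl1 trX z by auto
    then show ?thesis using z id2 tr2 \<tau>(3) fix\<sigma> uv by (auto simp: occ_def)
  qed
  have on_v: "?\<sigma>' z = (transpose a b \<circ> \<rho>2) z" if z: "z \<in> occ v" for z
  proof -
    have "\<rho>2 z \<in> occ v" "transpose a b (\<rho>2 z) \<in> occ v" using cl2 tr2X z by auto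
    then show ?thesis using z id tr \<tau>(3) fix\<sigma> uv by (auto simp: occ_def)
  qed
  have "resolves (insert u (insert v S)) ?\<sigma>'"
    unfolding resolves_def
  proof (intro conjI ballI impI)
    show "?\<sigma>' permutes X" using permutes_compose[OF \<rho>2X permutes_compose[OF \<rho>1X \<sigma>p]] by (simp only: comp_assoc)
    show "cyclic_on (c \<circ> ?\<sigma>') X" using \<rho>2(3) by (simp add: comp_assoc)
    show "?\<sigma>' z = z" if "z \<in> X" "cl z \<notin> insert u (insert v S)" for z
      using off[of z] that \<tau>(3) fix\<sigma> by simp
    fix w assume w: "w \<in> insert u (insert v S)"
    consider "w = u" | "w = v" | "w \<noteq> u" "w \<noteq> v" by blast
    then show "cyclic_on ?\<sigma>' (occ w)"
    proof cases
      case 1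
      have "cyclic_on (transpose s t \<circ> \<rho>1) (insert t (occ u - {t}))"
        by (rule cyclic_on_insert_left) (use \<rho>1 st in auto)
      then have "cyclic_on (transpose s t \<circ> \<rho>1) (occ u)" using st by (simp add: insert_absorb)
      then show ?thesis unfolding 1 by (rule cyclic_on_congI[OF _ on_u])
    next
      case 2
      have "cyclic_on (transpose a b \<circ> \<rho>2) (insert b (occ v - {b}))"
        by (rule cyclic_on_insert_left) (use \<rho>2 ab in auto)
      then have "cyclic_on (transpose a b \<circ> \<rho>2) (occ v)" using ab by (simp add: insert_absorb)
      then show ?thesis unfolding 2 by (rule cyclic_on_congI[OF _ on_v])
    next
      case 3
      have "?\<sigma>' z = (\<sigma> \<circ> \<tau>) z" if "z \<in> occ w" for z
        using off[of z] that 3 by (simp add: occ_def)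
      then show ?thesis using cyclic_on_congI[of "\<sigma> \<circ> \<tau>" "occ w" ?\<sigma>'] \<tau>(4)[of w] w 3 by blast
    qed
  qed
  then show ?thesis by blast
qed

text \<open>A transposition in the class of \<open>u\<close> cuts off the gap that contains
  \<open>a\<close> but not \<open>b\<close>; the transposition of \<open>a\<close> and
  \<open>b\<close> glues it back. No third class is touched, so \<open>\<tau>\<close> is
  \<open>id\<close>.\<close>

lemma resolve_interlaced:
  assumes r: "resolves S \<sigma>" and uv: "u \<noteq> v" "u \<notin> S" "v \<notin> S"
    and even: "even (card (occ u))" "even (card (occ v))"
    and ab: "a \<in> occ v" "b \<in> occ v" and ne: "occ u \<noteq> {}"
    and sep: "first_hit (c \<circ> \<sigma>) (occ u) a \<noteq> first_hit (c \<circ> \<sigma>) (occ u) b"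
  shows "\<exists>\<sigma>'. resolves (insert u (insert v S)) \<sigma>'"
proof -
  let ?p = "c \<circ> \<sigma>" and ?h = "first_hit (c \<circ> \<sigma>) (occ u)"
  have p: "permutation ?p" "cyclic_on ?p X"
    using resolves_step_permutation[OF r] r by (auto simp: resolves_def)
  have aX: "a \<in> X" "b \<in> X" using ab by (auto simp: occ_def)
  have ne': "occ u \<inter> X \<noteq> {}" using ne occ_subset by blast
  have h: "?h a \<in> occ u" "?h b \<in> occ u" using first_hit_in[OF p(2) ne'] aX by auto
  obtain s where s: "s \<in> occ u" "s \<noteq> ?h a" "?h (?p s) = ?h a"
    "cyclic_on (?p \<circ> transpose s (?h a)) {z \<in> X. ?h z = ?h a}"
    "cyclic_on (?p \<circ> transpose s (?h a)) {z \<in> X. ?h z \<noteq> ?h a}"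
    using cyclic_on_split_gap[OF p occ_subset h sep[symmetric]] .
  have "cyclic_on (?p \<circ> transpose s (?h a) \<circ> transpose a b)
      ({z \<in> X. ?h z = ?h a} \<union> {z \<in> X. ?h z \<noteq> ?h a})"
    by (rule cyclic_on_merge[OF s(4,5)]) (use aX sep in auto)
  moreover have "{z \<in> X. ?h z = ?h a} \<union> {z \<in> X. ?h z \<noteq> ?h a} = X" by blast
  ultimately have "cyclic_on (c \<circ> \<sigma> \<circ> transpose s (?h a) \<circ> id \<circ> transpose a b) X" by simp
  moreover have "cyclic_on (\<sigma> \<circ> id) (occ w)" if "w \<in> S" for w
    using r that by (simp add: resolves_def)
  moreover have "a \<noteq> b" using sep by blast
  ultimately show ?thesis
    using resolve_even_pair[OF r uv even permutes_id _ _ _ s(1) h(1) s(2) ab] by simp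
qed

text \<open>The gap of \<open>u\<close> containing \<open>z\<close> is cut off, the rest is cut between \<open>x\<close> and \<open>y\<close> into two
  cycles both meeting \<open>v\<close>, the gap is glued to one of them at \<open>w\<close> (to which one is dictated by
  the permutation at \<open>w\<close> having to stay cyclic), and the last two cycles are merged at \<open>v\<close>.\<close>

lemma resolve_via_third:
  assumes r: "resolves S \<sigma>" and uv: "u \<noteq> v" "u \<notin> S" "v \<notin> S" and w: "w \<in> S"
    and even: "even (card (occ u))" "even (card (occ v))"
    and ne: "occ u \<noteq> {}" "occ v \<noteq> {}"
    and xyz: "x \<in> occ w" "y \<in> occ w" "z \<in> occ w"
    and gap_u: "first_hit (c \<circ> \<sigma>) (occ u) x \<noteq> first_hit (c \<circ> \<sigma>) (occ u) z"
      "first_hit (c \<circ> \<sigma>) (occ u) y \<noteq> first_hit (c \<circ> \<sigma>) (occ u) z"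
      "\<And>a. a \<in> occ v \<Longrightarrow> first_hit (c \<circ> \<sigma>) (occ u) a \<noteq> first_hit (c \<circ> \<sigma>) (occ u) z"
    and gap_v: "first_hit (c \<circ> \<sigma>) (occ v) x \<noteq> first_hit (c \<circ> \<sigma>) (occ v) y"
  shows "\<exists>\<sigma>'. resolves (insert u (insert v S)) \<sigma>'"
proof -
  let ?p = "c \<circ> \<sigma>" and ?h = "first_hit (c \<circ> \<sigma>) (occ u)"
  have p: "permutation ?p" "cyclic_on ?p X"
    using resolves_step_permutation[OF r] r by (auto simp: resolves_def)
  have X: "x \<in> X" "y \<in> X" "z \<in> X" and cl: "cl x = w" "cl y = w" "cl z = w"
    using xyz by (auto simp: occ_def)
  have wuv: "w \<noteq> u" "w \<noteq> v" using w uv by auto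
  have neq: "x \<noteq> y" "x \<noteq> z" "y \<noteq> z" using gap_u gap_v by auto
  have ne': "occ u \<inter> X \<noteq> {}" using ne occ_subset by blast
  have t: "?h z \<in> occ u" "?h x \<in> occ u" using first_hit_in[OF p(2) ne'] X by auto
  obtain s where s: "s \<in> occ u" "s \<noteq> ?h z" "?h (?p s) = ?h z"
    "cyclic_on (?p \<circ> transpose s (?h z)) {y \<in> X. ?h y = ?h z}"
    "cyclic_on (?p \<circ> transpose s (?h z)) {y \<in> X. ?h y \<noteq> ?h z}"
    using cyclic_on_split_gap[OF p occ_subset t gap_u(1)] .
  let ?q = "?p \<circ> transpose s (?h z)" and ?W = "{y \<in> X. ?h y = ?h z}" and ?A = "{y \<in> X. ?h y \<noteq> ?h z}"
  have q: "permutation ?q" using p(1) by (simp add: permutation_compose permutation_swap_id)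
  have vA: "occ v \<subseteq> ?A" using gap_u(3) occ_subset by auto
  \<comment> \<open>The gap cut off contains no element of class \<open>v\<close>, so the gaps of
    \<open>v\<close> still separate \<open>x\<close> from \<open>y\<close>.\<close>
  have gap_q: "first_hit ?q (occ v) y = first_hit ?p (occ v) y" if "y \<in> ?A" for y
    by (rule first_hit_split_gap[OF p occ_subset s(1) t(1) s(2,3) vA ne(2) occ_disjoint])
      (use that uv in auto)
  have xyA: "x \<in> ?A" "y \<in> ?A" "x \<notin> occ v" "y \<notin> occ v" using X gap_u cl wuv by (auto simp: occ_def)
  have "first_hit ?q (occ v) x \<noteq> first_hit ?q (occ v) y"
    using gap_q[OF xyA(1)] gap_q[OF xyA(2)] gap_v by simp
  from cyclic_on_split_interlaced[OF q s(5) xyA vA ne(2) this]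
  obtain B C where BC: "B \<inter> C = {}" "B \<union> C = ?A" "x \<in> B" "y \<in> C"
      "occ v \<inter> B \<noteq> {}" "occ v \<inter> C \<noteq> {}"
    and cyc: "cyclic_on (?q \<circ> transpose x y) B" "cyclic_on (?q \<circ> transpose x y) C" .
  have W: "cyclic_on (?q \<circ> transpose x y) ?W" "z \<in> ?W"
    using cyclic_on_transpose_outside[OF s(4)] gap_u X by auto
  have disj: "?W \<inter> B = {}" "?W \<inter> C = {}" "x \<notin> ?W" "y \<notin> ?W" and un: "B \<union> C \<union> ?W = X"
    using BC(2) gap_u by auto
  obtain a b where ab: "a \<in> occ v" "a \<in> B" "b \<in> occ v" "b \<in> C" using BC by blast
  have abne: "a \<noteq> b" using ab BC by auto
  have \<sigma>: "permutation \<sigma>" "cyclic_on \<sigma> (occ w)"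
    using r w permutes_imp_permutation[OF finite_X] by (auto simp: resolves_def)
  \<comment> \<open>The transposition of \<open>x\<close> and \<open>y\<close> also breaks the cycle
    of \<open>\<sigma>\<close> at \<open>w\<close>. Attaching \<open>z\<close> to the end lying in
    the other piece repairs it; either choice glues \<open>?W\<close>, the cycle of
    \<open>z\<close>, to one of \<open>B\<close> and \<open>C\<close>.\<close>
  obtain B' C' where BC': "B' \<inter> C' = {}" "B' \<union> C' = occ w" "x \<in> B'" "y \<in> C'"
    "cyclic_on (\<sigma> \<circ> transpose x y) B'" "cyclic_on (\<sigma> \<circ> transpose x y) C'"
    using cyclic_on_split_pair[OF \<sigma> xyz(1,2) neq(1)] .
  have finish: ?thesis
    if k: "k \<in> {x, y}" and w': "cyclic_on (\<sigma> \<circ> transpose x y \<circ> transpose k z) (occ w)"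
      and single: "cyclic_on (?q \<circ> transpose x y \<circ> transpose k z \<circ> transpose a b) X" for k
  proof -
    define \<tau> where "\<tau> = transpose x y \<circ> transpose k z"
    have kw: "k \<in> occ w" using k xyz by auto
    have 1: "\<tau> permutes X"
      unfolding \<tau>_def using kw X by (intro permutes_compose permutes_swap_id) (auto simp: occ_def)
    have 2: "cl (\<tau> d) = cl d" if "d \<in> X" for d
      using kw cl by (auto simp: \<tau>_def occ_def transpose_def)
    have idw: "\<tau> d = d" if "cl d \<noteq> w" for d
      using kw cl that by (auto simp: \<tau>_def occ_def transpose_def)
    have 3: "\<tau> d = d" if "d \<in> X" "cl d \<notin> S" for d
      by (rule idw) (use that w in blast)
    have 4: "cyclic_on (\<sigma> \<circ> \<tau>) (occ w')" if S: "w' \<in> S" for w'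
    proof (cases "w' = w")
      case True
      then show ?thesis using w' by (simp add: \<tau>_def comp_assoc)
    next
      case False
      have "cyclic_on \<sigma> (occ w')" using r S by (simp add: resolves_def)
      then show ?thesis by (rule cyclic_on_congI) (use idw False in \<open>simp add: occ_def\<close>)
    qed
    have "cyclic_on (?p \<circ> transpose s (?h z) \<circ> \<tau> \<circ> transpose a b) X"
      using single by (simp add: \<tau>_def comp_assoc)
    with resolve_even_pair[OF r uv even 1 2 3 4 s(1) t(1) s(2) ab(1,3) abne]
    show ?thesis by blast
  qed
  show ?thesis
  proof (cases "z \<in> B'")
    case True
    have w': "cyclic_on (\<sigma> \<circ> transpose x y \<circ> transpose y z) (C' \<union> B')"
      by (rule cyclic_on_merge) (use BC' True in auto)
    have 1: "cyclic_on (?q \<circ> transpose x y \<circ> transpose y z) (C \<union> ?W)"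
      by (rule cyclic_on_merge) (use cyc W BC disj in auto)
    have 2: "cyclic_on (?q \<circ> transpose x y \<circ> transpose y z) B"
      by (rule cyclic_on_transpose_outside) (use cyc W BC disj in auto)
    have "cyclic_on (?q \<circ> transpose x y \<circ> transpose y z \<circ> transpose a b) (B \<union> (C \<union> ?W))"
      by (rule cyclic_on_merge[OF 2 1]) (use ab BC disj in auto)
    moreover have "B \<union> (C \<union> ?W) = X" using un by blast
    ultimately show ?thesis using finish[of y] w' BC'(2) by (simp add: Un_commute)
  next
    case False
    then have z: "z \<in> C'" using BC' xyz by auto
    have w': "cyclic_on (\<sigma> \<circ> transpose x y \<circ> transpose x z) (B' \<union> C')"
      by (rule cyclic_on_merge) (use BC' z in auto)
    have 1: "cyclic_on (?q \<circ> transpose x y \<circ> transpose x z) (B \<union> ?W)"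
      by (rule cyclic_on_merge) (use cyc W BC disj in auto)
    have 2: "cyclic_on (?q \<circ> transpose x y \<circ> transpose x z) C"
      by (rule cyclic_on_transpose_outside) (use cyc W BC disj in auto)
    have "cyclic_on (?q \<circ> transpose x y \<circ> transpose x z \<circ> transpose a b) ((B \<union> ?W) \<union> C)"
      by (rule cyclic_on_merge[OF 1 2]) (use ab BC disj in auto)
    moreover have "(B \<union> ?W) \<union> C = X" using un by blast
    ultimately show ?thesis using finish[of x] w' BC'(2) by simp
  qed
qed

end

section \<open>Two unresolved vertices in a dense graph\<close>

text \<open>The alternatives correspond to which of the two sets is met first: if it is
  \<open>L\<close>, the walk towards \<open>K\<close> goes on from that element of \<open>L\<close>,
  and vice versa.\<close>

lemma first_hit_dichotomy:
  assumes p: "cyclic_on p A" and K: "K \<inter> A \<noteq> {}" and L: "L \<inter> A \<noteq> {}" and z: "z \<in> A"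
  shows "first_hit p K z = first_hit p K (first_hit p L z) \<or>
    first_hit p L z = first_hit p L (first_hit p K z)"
proof -
  have KL: "(K \<union> L) \<inter> A \<noteq> {}" using K by auto
  from p KL z show ?thesis
  proof (induct rule: first_hit_induct)
    case (base z)
    then show ?case by (auto simp: first_hit_self)
  next
    case (step z)
    then show ?case using first_hit_step[OF p K, of z] first_hit_step[OF p L, of z] by simp
  qed
qed

text \<open>Elements of \<open>X\<close> are cells of a grid, with rows the values of \<open>g\<close> and columns
  those of \<open>h\<close>; the cells lying neither in the row nor in the column of a given one are few.\<close>

lemma no_sparse_grid:
  fixes g :: "'v \<Rightarrow> 'r" and h :: "'v \<Rightarrow> 's"
  assumes fin: "finite X" and sub: "Y \<subseteq> X" "Z \<subseteq> X"
    and Y: "\<And>t. card {y \<in> Y. g y = t} \<le> 2" and Z: "\<And>t. card {z \<in> Z. h z = t} \<le> 2"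
    and far: "\<And>w. w \<in> X \<Longrightarrow> card {x \<in> X. g x \<noteq> g w \<and> h x \<noteq> h w} \<le> d"
    and big: "card Y \<ge> 3 * d + 3" "card Z \<ge> 3 * d + 3"
  shows False
proof -
  have finYZ: "finite Y" "finite Z" using fin sub by (auto intro: finite_subset)
  \<comment> \<open>At most 2 elements of \<open>Y\<close> share the row of \<open>w\<close> and at
    most \<open>d\<close> avoid both its row and column, which leaves
    \<open>(3 * d + 3) - 2 - d\<close> in the column.\<close>
  have col: "2 * d + 1 \<le> card {y \<in> Y. h y = h w}" if w: "w \<in> X" for w
  proof -
    have "Y \<subseteq> {y \<in> Y. g y = g w} \<union> {y \<in> Y. h y = h w} \<union> {x \<in> X. g x \<noteq> g w \<and> h x \<noteq> h w}"
      using sub by auto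
    then have "card Y \<le> card ({y \<in> Y. g y = g w} \<union> {y \<in> Y. h y = h w} \<union> {x \<in> X. g x \<noteq> g w \<and> h x \<noteq> h w})"
      using fin finYZ by (intro card_mono) auto
    also have "\<dots> \<le> card {y \<in> Y. g y = g w} + card {y \<in> Y. h y = h w} + card {x \<in> X. g x \<noteq> g w \<and> h x \<noteq> h w}"
      by (meson card_Un_le add_le_mono1 le_trans)
    finally show ?thesis using Y[of "g w"] far[OF w] big by linarith
  qed
  \<comment> \<open>Seen from \<open>y\<close>, an element of another column is either in the row of
    \<open>y\<close>, which has at most one further element of \<open>Y\<close>, or one of the
    \<open>d\<close> far ones.\<close>
  have other: "card {x \<in> Y. h x = h w} \<le> d + 1" if y: "y \<in> Y" and w: "h w \<noteq> h y" for y w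
  proof -
    have "{x \<in> Y. h x = h w} \<subseteq> ({x \<in> Y. g x = g y} - {y}) \<union> {x \<in> X. g x \<noteq> g y \<and> h x \<noteq> h y}"
      using sub w by auto
    then have "card {x \<in> Y. h x = h w} \<le> card (({x \<in> Y. g x = g y} - {y}) \<union> {x \<in> X. g x \<noteq> g y \<and> h x \<noteq> h y})"
      using fin finYZ by (intro card_mono) auto
    also have "\<dots> \<le> card ({x \<in> Y. g x = g y} - {y}) + card {x \<in> X. g x \<noteq> g y \<and> h x \<noteq> h y}"
      by (rule card_Un_le)
    also have "card ({x \<in> Y. g x = g y} - {y}) = card {x \<in> Y. g x = g y} - 1"
      using y finYZ by (intro card_Diff_singleton) auto
    finally show ?thesis using Y[of "g y"] far[of y] y sub by fastforce
  qed
  obtain w where w: "w \<in> X" using big(1) sub by (metis add_leD2 card.empty ex_in_conv not_numeral_le_zero subsetD)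
  show False
  \<comment> \<open>With a single column, all of \<open>Z\<close> would be in it. With two columns,
    \<open>2 * d + 1 \<le> d + 1\<close> forces \<open>d = 0\<close>; then nothing is far from
    \<open>y\<close>, which is alone in its column, so all of \<open>Y\<close> is in one
    row.\<close>
  proof (cases "\<exists>w'\<in>X. h w' \<noteq> h w")
    case False
    then have "{z \<in> Z. h z = h w} = Z" using sub by auto
    then show False using Z[of "h w"] big(2) by simp
  next
    case True
    then obtain w' where w': "w' \<in> X" "h w' \<noteq> h w" by blast
    have ex: "\<exists>y\<in>Y. h y = h q" if "q \<in> X" for q
    proof -
      have "{y \<in> Y. h y = h q} \<noteq> {}" using col[OF that] by (metis card.empty add_is_0 le_zero_eq one_neq_zero)
      then show ?thesis by blast
    qed
    obtain y where y: "y \<in> Y" "h y = h w" using ex[OF w] by blast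
    obtain y' where y': "y' \<in> Y" "h y' = h w'" using ex[OF w'(1)] by blast
    have "card {x \<in> Y. h x = h w'} \<le> d + 1" using other[OF y(1), of w'] w' y by simp
    with col[OF w'(1)] have d: "d = 0" by linarith
    have "card {x \<in> Y. h x = h w} \<le> 1" using other[OF y'(1), of w] w' y' d by simp
    then have one: "x = y" if "x \<in> Y" "h x = h w" for x
      using that y finYZ by (auto simp: card_le_Suc0_iff_eq)
    have "x \<notin> Y \<or> g x = g y" for x
    proof (rule ccontr)
      assume x: "\<not> (x \<notin> Y \<or> g x = g y)"
      then have "h x \<noteq> h y" using one y by metis
      then have "x \<in> {x \<in> X. g x \<noteq> g y \<and> h x \<noteq> h y}" using x sub by auto
      moreover have "{x \<in> X. g x \<noteq> g y \<and> h x \<noteq> h y} = {}" using far[of y] y sub d fin by auto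
      ultimately show False by blast
    qed
    then have "{x \<in> Y. g x = g y} = Y" by auto
    then show False using Y[of "g y"] big(1) by simp
  qed
qed

section \<open>Adjacency in the word and the grid of gaps\<close>

context cyclic_word
begin

text \<open>Adjacency as read off the word. For the arcs of an euler circuit, classified by their
  heads, the classes of \<open>a\<close> and \<open>c a\<close> are the two ends of the arc
  \<open>c a\<close>.\<close>

definition nbrs :: "'a \<Rightarrow> 'a set" where
  "nbrs v = {w. w \<noteq> v \<and> (\<exists>a\<in>X. cl a = v \<and> cl (c a) = w \<or> cl a = w \<and> cl (c a) = v)}"

text \<open>\<open>\<sigma>\<close> preserves classes, so a consecutive pair \<open>b\<close>,
  \<open>c b\<close> may be replaced by the preimage of \<open>b\<close> under
  \<open>\<sigma>\<close> and \<open>c b\<close>.\<close>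

lemma nbrs_step:
  assumes r: "resolves S \<sigma>" and y: "y \<in> nbrs v"
  obtains a where "a \<in> X" "(c \<circ> \<sigma>) a \<in> X"
    "cl a = v \<and> cl ((c \<circ> \<sigma>) a) = y \<or> cl a = y \<and> cl ((c \<circ> \<sigma>) a) = v"
proof -
  obtain b where b: "b \<in> X" "cl b = v \<and> cl (c b) = y \<or> cl b = y \<and> cl (c b) = v"
    using y by (auto simp: nbrs_def)
  have \<sigma>: "\<sigma> permutes X" using r by (simp add: resolves_def)
  let ?a = "inv \<sigma> b"
  have a: "?a \<in> X" "\<sigma> ?a = b"
    using permutes_in_image[OF permutes_inv[OF \<sigma>], of b] permutes_inverses(1)[OF \<sigma>] b by auto
  have "cl ?a = cl b" using resolves_class(2)[OF r a(1)] a(2) by simp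
  then show ?thesis
    using that[OF a(1)] a b permutes_in_image[OF c_permutes, of b] by simp
qed

lemma nbrs_subset: "nbrs v \<subseteq> cl ` X - {v}"
  using permutes_in_image[OF c_permutes] by (auto simp: nbrs_def)

lemma finite_nbrs: "finite (nbrs v)"
  using nbrs_subset finite_X by (meson finite_Diff finite_imageI finite_subset)

text \<open>The neighbours of \<open>u\<close> read off at the two ends of one gap between consecutive
  elements of \<open>occ u\<close>.\<close>

definition gap_nbrs :: "('b \<Rightarrow> 'b) \<Rightarrow> 'a \<Rightarrow> 'b \<Rightarrow> 'a set" where
  "gap_nbrs p u t = {y. y \<noteq> u \<and> (\<exists>a\<in>X. (cl a = u \<and> cl (p a) = y \<and> first_hit p (occ u) (p a) = t) \<or>
      (cl a = y \<and> cl (p a) = u \<and> first_hit p (occ u) a = t))}"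

text \<open>A gap has one entrance and one exit: a unique \<open>s\<close> in \<open>occ u\<close>
  leads into it, and a unique element precedes \<open>t\<close>.\<close>

lemma card_gap_nbrs:
  assumes p: "p permutes X" "cyclic_on p X"
  shows "finite (gap_nbrs p u t)" "card (gap_nbrs p u t) \<le> 2"
proof -
  let ?h = "first_hit p (occ u)"
  let ?R = "{s \<in> occ u. ?h (p s) = t}"
  have "inj_on (\<lambda>s. ?h (p s)) (occ u)" using first_hit_return_inj[OF p(2) occ_subset] .
  then have R: "card ?R \<le> 1" "finite ?R"
    using finite_occ by (auto simp: card_le_Suc0_iff_eq inj_on_def)
  have sub: "gap_nbrs p u t \<subseteq> insert (cl (inv p t)) ((\<lambda>s. cl (p s)) ` ?R)"
  proof
    fix y assume "y \<in> gap_nbrs p u t"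
    then obtain a where a: "a \<in> X" "y \<noteq> u"
      "(cl a = u \<and> cl (p a) = y \<and> ?h (p a) = t) \<or> (cl a = y \<and> cl (p a) = u \<and> ?h a = t)"
      by (auto simp: gap_nbrs_def)
    from a(3) show "y \<in> insert (cl (inv p t)) ((\<lambda>s. cl (p s)) ` ?R)"
    proof
      assume "cl a = u \<and> cl (p a) = y \<and> ?h (p a) = t"
      then show ?thesis using a(1) by (auto simp: occ_def)
    next
      assume h: "cl a = y \<and> cl (p a) = u \<and> ?h a = t"
      then have pa: "p a \<in> occ u" "a \<notin> occ u"
        using a permutes_in_image[OF p(1)] by (auto simp: occ_def)
      have "occ u \<inter> X \<noteq> {}" using pa(1) occ_subset by blast
      then have "p a = t" using first_hit_step[OF p(2) _ a(1) pa(2)] pa(1) h by (simp add: first_hit_self)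
      then have "inv p t = a" using permutes_inverses(2)[OF p(1)] by blast
      then show ?thesis using h by simp
    qed
  qed
  show "finite (gap_nbrs p u t)" using sub R by (meson finite_imageI finite_insert finite_subset)
  have "card (gap_nbrs p u t) \<le> card (insert (cl (inv p t)) ((\<lambda>s. cl (p s)) ` ?R))"
    using sub R by (intro card_mono) auto
  also have "\<dots> \<le> Suc (card ((\<lambda>s. cl (p s)) ` ?R))" using R by (simp add: card_insert_if)
  also have "\<dots> \<le> 2" using card_image_le[OF R(2), of "\<lambda>s. cl (p s)"] R(1) by linarith
  finally show "card (gap_nbrs p u t) \<le> 2" .
qed

text \<open>An occurrence of \<open>y\<close> next to an occurrence of \<open>u\<close> is one step
  away from it, and no element of class \<open>v\<close> separates the two, so they share a gap of
  \<open>v\<close>.\<close>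

lemma nbrs_gap_nbrs:
  assumes r: "resolves S \<sigma>" and y: "y \<in> nbrs u" and v: "v \<noteq> u" "occ v \<noteq> {}" "v \<noteq> y"
  obtains z a where "z \<in> occ y" "a \<in> occ u" "y \<in> gap_nbrs (c \<circ> \<sigma>) u (first_hit (c \<circ> \<sigma>) (occ u) z)"
    "first_hit (c \<circ> \<sigma>) (occ v) z = first_hit (c \<circ> \<sigma>) (occ v) a"
proof -
  let ?p = "c \<circ> \<sigma>"
  have p: "cyclic_on ?p X" using r by (simp add: resolves_def)
  have ne: "occ v \<inter> X \<noteq> {}" using v occ_subset by blast
  have yu: "y \<noteq> u" using y by (simp add: nbrs_def)
  obtain a where a: "a \<in> X" "?p a \<in> X" "cl a = u \<and> cl (?p a) = y \<or> cl a = y \<and> cl (?p a) = u"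
    using nbrs_step[OF r y] .
  have "a \<notin> occ v" using a v by (auto simp: occ_def)
  note hit = first_hit_step[OF p ne a(1) this]
  from a(3) show ?thesis
  proof
    assume h: "cl a = u \<and> cl (?p a) = y"
    show ?thesis
    proof (rule that[of "?p a" a])
      show "y \<in> gap_nbrs ?p u (first_hit ?p (occ u) (?p a))"
        unfolding gap_nbrs_def using h a yu by blast
    qed (use h a hit in \<open>auto simp: occ_def\<close>)
  next
    assume h: "cl a = y \<and> cl (?p a) = u"
    show ?thesis
    proof (rule that[of a "?p a"])
      show "y \<in> gap_nbrs ?p u (first_hit ?p (occ u) a)"
        unfolding gap_nbrs_def using h a yu by blast
    qed (use h a hit in \<open>auto simp: occ_def\<close>)
  qed
qed

lemma at_most_one_unresolved:
  fixes \<delta> :: nat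
  assumes r: "resolves S \<sigma>"
    and maximal: "\<And>S' \<sigma>'. S \<subset> S' \<Longrightarrow> S' \<subseteq> cl ` X \<Longrightarrow> \<not> resolves S' \<sigma>'"
    and S: "S \<subseteq> cl ` X"
    and deg: "\<And>v. v \<in> cl ` X \<Longrightarrow> \<delta> \<le> card (nbrs v)"
    and dense: "5 * \<delta> \<ge> 4 * card (cl ` X) + 2"
    and uv0: "u0 \<in> cl ` X - S" "v0 \<in> cl ` X - S"
  shows "u0 = v0"
proof (rule ccontr)
  assume neq0: "u0 \<noteq> v0"
  let ?V = "cl ` X"
  define p where "p = c \<circ> \<sigma>"
  define h where "h u = first_hit p (occ u)" for u
  have p: "p permutes X" "cyclic_on p X"
    using resolves_step_permutes[OF r] r by (auto simp: p_def resolves_def)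
  have finV: "finite ?V" using finite_X by simp
  have ne: "occ v \<noteq> {}" "occ v \<inter> X \<noteq> {}" if "v \<in> ?V" for v
    using that by (auto simp: occ_def)
  have even: "even (card (occ u))" if u: "u \<in> ?V - S" for u
    using resolve_odd[OF r, of u] maximal[of "insert u S"] S u by auto
  have noext: "\<not> resolves (insert u (insert v S)) \<sigma>'" if "u \<in> ?V - S" "v \<in> ?V - S" for u v \<sigma>'
    by (rule maximal) (use S that in auto)
  \<comment> \<open>Otherwise \<open>u\<close> and \<open>v\<close> are interlaced and both can be
    added to \<open>S\<close>.\<close>
  have const: "h u a = h u b" if uv: "u \<in> ?V - S" "v \<in> ?V - S" "u \<noteq> v" and ab: "a \<in> occ v" "b \<in> occ v"
    for u v a b
    using resolve_interlaced[OF r uv(3) _ _ even even ab] noext[OF uv(1,2)] ne[of u] uv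
    unfolding h_def p_def by auto
  \<comment> \<open>The gap of \<open>u\<close> that contains all of class \<open>v\<close>; by
    \<open>const\<close> the chosen representative is immaterial.\<close>
  define e where "e u v = h u (SOME a. a \<in> occ v)" for u v
  have e: "h u a = e u v" if "u \<in> ?V - S" "v \<in> ?V - S" "u \<noteq> v" "a \<in> occ v" for u v a
    unfolding e_def using const[OF that] someI[of "\<lambda>a. a \<in> occ v" a] that(4) by blast
  have h_in: "h u x \<in> occ u" if "u \<in> ?V" "x \<in> X" for u x
    using first_hit_in[OF p(2) ne(2)[OF that(1)] that(2)] by (simp add: h_def)
  \<comment> \<open>An element outside the gap of \<open>v\<close> that contains \<open>u\<close>
    meets \<open>v\<close> before \<open>u\<close>, hence lies in the gap of \<open>u\<close> that
    contains \<open>v\<close>.\<close>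
  have excl: "h u x = e u v" if uv: "u \<in> ?V - S" "v \<in> ?V - S" "u \<noteq> v" and x: "x \<in> X" "h v x \<noteq> e v u"
    for u v x
  proof -
    have uvV: "u \<in> ?V" "v \<in> ?V" using uv by auto
    have "h u x = h u (h v x) \<or> h v x = h v (h u x)"
      using first_hit_dichotomy[OF p(2) ne(2)[OF uvV(1)] ne(2)[OF uvV(2)] x(1)] by (simp add: h_def)
    moreover have "h v (h u x) = e v u" using e[OF uv(2,1)] uv(3) h_in[OF uvV(1) x(1)] by auto
    moreover have "h u (h v x) = e u v" using e[OF uv] h_in[OF uvV(2) x(1)] by auto
    ultimately show ?thesis using x(2) by simp
  qed
  \<comment> \<open>\<open>I u v\<close> consists of the classes occurring in a gap of
    \<open>u\<close> free of \<open>v\<close>, and \<open>g u v w\<close> is one such gap for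
    \<open>w\<close>. On \<open>Q u v\<close> the values \<open>g u v w\<close> and
    \<open>g v u w\<close> are the grid coordinates.\<close>
  define I where "I u v = {w \<in> ?V. w \<noteq> u \<and> (\<exists>z\<in>occ w. h u z \<noteq> e u v)}" for u v
  define g where "g u v w = h u (SOME z. z \<in> occ w \<and> h u z \<noteq> e u v)" for u v w
  define Q where "Q u v = I u v \<inter> I v u" for u v
  have gI: "\<exists>z\<in>occ w. h u z = g u v w \<and> g u v w \<noteq> e u v" if "w \<in> I u v" for u v w
  proof -
    have "\<exists>z. z \<in> occ w \<and> h u z \<noteq> e u v" using that by (auto simp: I_def)
    from someI_ex[OF this] show ?thesis unfolding g_def by blast
  qed
  \<comment> \<open>An unresolved \<open>w\<close> would lie in a single gap of \<open>v\<close>,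
    one free of \<open>u\<close>; by \<open>excl\<close> it could not then occur in a gap of
    \<open>u\<close> free of \<open>v\<close>.\<close>
  have Q_S: "w \<in> S" if uv: "u \<in> ?V - S" "v \<in> ?V - S" "u \<noteq> v" and w: "w \<in> Q u v" for u v w
  proof (rule ccontr)
    assume "w \<notin> S"
    then have wV: "w \<in> ?V - S" "w \<noteq> u" "w \<noteq> v" using w by (auto simp: Q_def I_def)
    obtain z x where zx: "z \<in> occ w" "h u z \<noteq> e u v" "x \<in> occ w" "h v x \<noteq> e v u"
      using w by (auto simp: Q_def I_def)
    have "h v z = h v x" using const[OF uv(2) wV(1) wV(3)[symmetric]] zx by blast
    then show False using excl[OF uv, of z] zx occ_subset by auto
  qed
  \<comment> \<open>An occurrence \<open>y\<close> outside both gaps, together with \<open>z\<close>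
    in the gap of \<open>u\<close> and \<open>x\<close> in the gap of \<open>v\<close>, would allow
    \<open>u\<close> and \<open>v\<close> to be added by way of \<open>w\<close>.\<close>
  have cross: "h u y = g u v w \<or> h v y = g v u w"
    if uv: "u \<in> ?V - S" "v \<in> ?V - S" "u \<noteq> v" and w: "w \<in> Q u v" and y: "y \<in> occ w" for u v w y
  proof (rule ccontr)
    assume no: "\<not> (h u y = g u v w \<or> h v y = g v u w)"
    obtain z where z: "z \<in> occ w" "h u z = g u v w" "g u v w \<noteq> e u v" using gI[of w u v] w by (auto simp: Q_def)
    obtain x where x: "x \<in> occ w" "h v x = g v u w" "g v u w \<noteq> e v u" using gI[of w v u] w by (auto simp: Q_def)
    have "h u x = e u v" using excl[OF uv, of x] x occ_subset by auto
    then have "\<exists>\<sigma>'. resolves (insert u (insert v S)) \<sigma>'"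
      using resolve_via_third[OF r uv(3) _ _ Q_S[OF uv w] even[OF uv(1)] even[OF uv(2)] _ _ x(1) y z(1)]
        uv ne no x z e[OF uv] by (auto simp: h_def p_def)
    then show False using noext[OF uv(1,2)] by blast
  qed
  \<comment> \<open>Such an occurrence lies in the gap of \<open>v\<close> containing
    \<open>u\<close>, so \<open>cross\<close> leaves only the first alternative; the choice made in
    \<open>g\<close> is forced.\<close>
  have unique: "h u z = g u v w"
    if uv: "u \<in> ?V - S" "v \<in> ?V - S" "u \<noteq> v" and w: "w \<in> Q u v" and z: "z \<in> occ w" "h u z \<noteq> e u v"
    for u v w z
  proof -
    have "h v z = e v u" using excl[OF uv(2,1) uv(3)[symmetric], of z] z occ_subset by auto
    moreover have "g v u w \<noteq> e v u" using gI[of w v u] w by (auto simp: Q_def)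
    ultimately show ?thesis using cross[OF uv w z(1)] by auto
  qed
  have I_sub: "I u v \<subseteq> ?V - {u, v}" if uv: "u \<in> ?V - S" "v \<in> ?V - S" "u \<noteq> v" for u v
    using e[OF uv] by (auto simp: I_def)
  \<comment> \<open>A neighbour of \<open>u\<close> outside \<open>I u v\<close> occurs only in the
    gap of \<open>u\<close> containing \<open>v\<close>, and at most two neighbours are found at the
    ends of that gap.\<close>
  have nbr_I: "\<delta> \<le> card (nbrs u \<inter> I u v) + 2" if uv: "u \<in> ?V - S" "v \<in> ?V - S" "u \<noteq> v" for u v
  proof -
    have "nbrs u - I u v \<subseteq> gap_nbrs p u (e u v)"
    proof
      fix y assume y: "y \<in> nbrs u - I u v"
      have "y \<in> ?V" "y \<noteq> u" using y nbrs_subset by auto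
      then have all: "h u z = e u v" if "z \<in> occ y" for z using y that by (auto simp: I_def)
      obtain b where b: "b \<in> X" "p b \<in> X" "cl b = u \<and> cl (p b) = y \<or> cl b = y \<and> cl (p b) = u"
        using nbrs_step[OF r, of y u] y unfolding p_def by blast
      then show "y \<in> gap_nbrs p u (e u v)"
        using all[of b] all[of "p b"] \<open>y \<noteq> u\<close> by (auto simp: gap_nbrs_def occ_def h_def)
    qed
    then have "card (nbrs u - I u v) \<le> 2"
      using card_gap_nbrs[OF p, of u "e u v"] card_mono order_trans by blast
    moreover have "card (nbrs u) = card (nbrs u \<inter> I u v) + card (nbrs u - I u v)"
      using finite_nbrs by (metis card_Int_Diff)
    ultimately show ?thesis using deg[of u] uv by auto
  qed
  \<comment> \<open>The occurrence of \<open>y\<close> beside \<open>u\<close> lies in the gap of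
    \<open>v\<close> containing \<open>u\<close>; by \<open>cross\<close> it lies in the gap
    \<open>g u v y\<close> of \<open>u\<close>, whose ends show at most two neighbours.\<close>
  have Q_nbr: "card {y \<in> nbrs u \<inter> Q u v. g u v y = t} \<le> 2"
    if uv: "u \<in> ?V - S" "v \<in> ?V - S" "u \<noteq> v" for u v t
  proof -
    have "{y \<in> nbrs u \<inter> Q u v. g u v y = t} \<subseteq> gap_nbrs p u t"
    proof
      fix y assume y: "y \<in> {y \<in> nbrs u \<inter> Q u v. g u v y = t}"
      then have yQ: "y \<in> nbrs u" "y \<in> Q u v" "g u v y = t" by auto
      have "v \<noteq> y" using yQ I_sub[OF uv] by (auto simp: Q_def)
      then obtain z a where za: "z \<in> occ y" "a \<in> occ u" "y \<in> gap_nbrs p u (h u z)" "h v z = h v a"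
        using nbrs_gap_nbrs[OF r yQ(1) uv(3)[symmetric]] ne[of v] uv unfolding h_def p_def by blast
      have "h v z = e v u" using e[OF uv(2,1)] za uv by auto
      moreover have "g v u y \<noteq> e v u" using gI[of y v u] yQ by (auto simp: Q_def)
      ultimately have "h u z = t" using cross[OF uv yQ(2) za(1)] yQ(3) by auto
      then show "y \<in> gap_nbrs p u t" using za by simp
    qed
    then show ?thesis using card_gap_nbrs[OF p] card_mono order_trans by blast
  qed
  \<comment> \<open>Two sets of at least \<open>\<delta> - 2\<close> classes each, inside the
    \<open>card ?V - 2\<close> classes other than \<open>u\<close> and \<open>v\<close>, overlap in
    at least \<open>2 * \<delta> - card ?V - 2\<close>.\<close>
  have Q_big: "2 * \<delta> \<le> card (nbrs u \<inter> Q u v) + 2 + card ?V"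
    if uv: "u \<in> ?V - S" "v \<in> ?V - S" "u \<noteq> v" for u v
  proof -
    let ?A = "nbrs u \<inter> I u v" and ?B = "I v u"
    have sub: "?A \<union> ?B \<subseteq> ?V - {u, v}" using I_sub[OF uv] I_sub[OF uv(2,1) uv(3)[symmetric]] by auto
    have "card (?V - {u, v}) = card ?V - 2"
      using uv finV by (subst card_Diff_subset) auto
    then have "card (?A \<union> ?B) \<le> card ?V - 2" using card_mono[OF _ sub] finV by auto
    moreover have "finite ?A" "finite ?B" using finV finite_nbrs by (auto simp: I_def)
    then have "card ?A + card ?B = card (?A \<union> ?B) + card (?A \<inter> ?B)" by (rule card_Un_Int)
    moreover have "card (nbrs v \<inter> I v u) \<le> card ?B" using finV by (intro card_mono) (auto simp: I_def)
    moreover have "?A \<inter> ?B = nbrs u \<inter> Q u v" by (auto simp: Q_def)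
    then have "card (?A \<inter> ?B) = card (nbrs u \<inter> Q u v)" by (rule arg_cong)
    moreover have "card ?V \<ge> 2"
    proof -
      have "card {u, v} \<le> card ?V" using uv finV by (intro card_mono) auto
      then show ?thesis using uv by simp
    qed
    ultimately show ?thesis using nbr_I[OF uv] nbr_I[OF uv(2,1) uv(3)[symmetric]] by linarith
  qed
  \<comment> \<open>Classes that differ from \<open>w\<close> in both coordinates are not adjacent
    to \<open>w\<close>, since consecutive elements outside \<open>u\<close> and \<open>v\<close>
    share their gaps. They are counted among the non-neighbours of \<open>w\<close>.\<close>
  have far: "card {x \<in> Q u v. g u v x \<noteq> g u v w \<and> g v u x \<noteq> g v u w} + \<delta> + 1 \<le> card ?V"
    if uv: "u \<in> ?V - S" "v \<in> ?V - S" "u \<noteq> v" and w: "w \<in> Q u v" for u v w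
  proof -
    let ?F = "{x \<in> Q u v. g u v x \<noteq> g u v w \<and> g v u x \<noteq> g v u w}"
    have wV: "w \<in> ?V" "w \<noteq> u" "w \<noteq> v" using w by (auto simp: Q_def I_def)
    have Q_sym: "Q v u = Q u v" by (auto simp: Q_def)
    \<comment> \<open>\<open>cross\<close> places \<open>a\<close> in one of the two gaps of its
      class; \<open>b\<close> shares that gap, and \<open>unique\<close> identifies it as the gap of
      the class of \<open>b\<close>.\<close>
    have close: "g u v (cl b) = g u v (cl a) \<or> g v u (cl b) = g v u (cl a)"
      if ab: "a \<in> X" "b \<in> X" "h u a = h u b" "h v a = h v b" "cl a \<in> Q u v" "cl b \<in> Q u v" for a b
    proof -
      have oc: "a \<in> occ (cl a)" "b \<in> occ (cl b)" using ab by (auto simp: occ_def)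
      have "g u v (cl a) \<noteq> e u v" "g v u (cl a) \<noteq> e v u"
        using gI[of "cl a" u v] gI[of "cl a" v u] ab by (auto simp: Q_def)
      then show ?thesis
        using cross[OF uv ab(5) oc(1)] unique[OF uv ab(6) oc(2)]
          unique[OF uv(2,1) uv(3)[symmetric], of "cl b" b] ab oc Q_sym by auto
    qed
    have "x \<notin> nbrs w" if x: "x \<in> ?F" for x
    proof
      assume "x \<in> nbrs w"
      then obtain a where a: "a \<in> X" "p a \<in> X" "cl a = w \<and> cl (p a) = x \<or> cl a = x \<and> cl (p a) = w"
        using nbrs_step[OF r] unfolding p_def by blast
      have xV: "x \<noteq> u" "x \<noteq> v" using x by (auto simp: Q_def I_def)
      then have notin: "a \<notin> occ u" "a \<notin> occ v" using a wV by (auto simp: occ_def)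
      have "h u a = h u (p a)" "h v a = h v (p a)"
        using first_hit_step[OF p(2) ne(2) a(1)] notin uv by (auto simp: h_def)
      then show False using close[of a "p a"] close[of "p a" a] a x w by auto
    qed
    then have "?F \<union> nbrs w \<subseteq> ?V - {w}" "?F \<inter> nbrs w = {}"
      using nbrs_subset by (auto simp: Q_def I_def)
    moreover have finF: "finite ?F" using finV by (auto simp: Q_def I_def)
    ultimately have "card ?F + card (nbrs w) \<le> card (?V - {w})"
      using finV finite_nbrs by (metis (no_types, lifting) card_Un_disjoint card_mono finite_Diff)
    moreover have "card (?V - {w}) = card ?V - 1" "card ?V > 0"
      using wV finV by (auto simp: card_gt_0_iff)
    ultimately show ?thesis using deg[OF wV(1)] by linarith
  qed
  have "card (nbrs u0) < card ?V"
    using nbrs_subset[of u0] finV uv0 by (intro psubset_card_mono) auto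
  \<comment> \<open>Keeps the natural-number subtraction in \<open>card ?V - 1 - \<delta>\<close>
    exact.\<close>
  then have small: "\<delta> < card ?V" using deg[of u0] uv0 by auto
  note uv = uv0 neq0 and vu = uv0(2,1) neq0[symmetric]
  have Q_sym: "Q v0 u0 = Q u0 v0" by (auto simp: Q_def)
  show False
  proof (rule no_sparse_grid[of "Q u0 v0" "nbrs u0 \<inter> Q u0 v0" "nbrs v0 \<inter> Q u0 v0" "g u0 v0" "g v0 u0" "card ?V - 1 - \<delta>"])
    show "finite (Q u0 v0)" using finV by (auto simp: Q_def I_def)
    show "card {y \<in> nbrs u0 \<inter> Q u0 v0. g u0 v0 y = t} \<le> 2" for t using Q_nbr[OF uv] .
    show "card {y \<in> nbrs v0 \<inter> Q u0 v0. g v0 u0 y = t} \<le> 2" for t using Q_nbr[OF vu] Q_sym by simp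
    show "card {x \<in> Q u0 v0. g u0 v0 x \<noteq> g u0 v0 w \<and> g v0 u0 x \<noteq> g v0 u0 w} \<le> card ?V - 1 - \<delta>"
      if "w \<in> Q u0 v0" for w
      using far[OF uv that] by linarith
    \<comment> \<open>The left side is \<open>3 * card ?V - 3 * \<delta>\<close>, and it is at most
      \<open>2 * \<delta> - card ?V - 2\<close> exactly when \<open>dense\<close> holds.\<close>
    show "3 * (card ?V - 1 - \<delta>) + 3 \<le> card (nbrs u0 \<inter> Q u0 v0)"
      using Q_big[OF uv] dense small by linarith
    show "3 * (card ?V - 1 - \<delta>) + 3 \<le> card (nbrs v0 \<inter> Q u0 v0)"
      using Q_big[OF vu] dense small unfolding Q_sym by linarith
  qed auto
qed

text \<open>If one even class stays unresolved, all its elements but one are permuted cyclically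
  first; a transposition then inserts the last one and splits the single cycle into two.\<close>

lemma dense_two_cycles:
  fixes \<delta> :: nat
  assumes deg: "\<And>v. v \<in> cl ` X \<Longrightarrow> \<delta> \<le> card (nbrs v)"
    and dense: "5 * \<delta> \<ge> 4 * card (cl ` X) + 2"
  obtains \<sigma> A B where "\<sigma> permutes X" "\<And>a. a \<in> X \<Longrightarrow> cl (\<sigma> a) = cl a"
    "\<And>v. v \<in> cl ` X \<Longrightarrow> cyclic_on \<sigma> (occ v)"
    "A \<union> B = X" "cyclic_on (c \<circ> \<sigma>) A" "cyclic_on (c \<circ> \<sigma>) B"
proof -
  let ?V = "cl ` X"
  have finV: "finite ?V" using finite_X by simp
  define F where "F = {S. S \<subseteq> ?V \<and> (\<exists>\<sigma>. resolves S \<sigma>)}"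
  have "finite F" by (rule finite_subset[of _ "Pow ?V"]) (use finV in \<open>auto simp: F_def\<close>)
  moreover have "{} \<in> F" unfolding F_def using resolves_empty by blast
  ultimately obtain S where S: "S \<in> F" "\<forall>S'\<in>F. S \<subseteq> S' \<longrightarrow> S = S'"
    using finite_has_maximal[of F] by blast
  then obtain \<sigma> where r: "resolves S \<sigma>" by (auto simp: F_def)
  have SV: "S \<subseteq> ?V" using S by (simp add: F_def)
  have maximal: "\<not> resolves S' \<sigma>'" if "S \<subset> S'" "S' \<subseteq> ?V" for S' \<sigma>'
    using S(2) that unfolding F_def by blast
  note one = at_most_one_unresolved[OF r maximal SV deg dense]
  show ?thesis
  proof (cases "S = ?V")
    case True
    show ?thesis
    \<comment> \<open>A single cycle is recorded as \<open>A = B = X\<close>.\<close>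
    proof (rule that[of \<sigma> X X])
      show "cyclic_on \<sigma> (occ v)" if "v \<in> ?V" for v
        using r that unfolding True resolves_def by blast
      show "\<sigma> permutes X" "cyclic_on (c \<circ> \<sigma>) X" "cyclic_on (c \<circ> \<sigma>) X"
        using r by (simp_all only: resolves_def)
      show "cl (\<sigma> a) = cl a" if "a \<in> X" for a using resolves_class(2)[OF r that] .
    qed simp
  next
    case False
    then obtain u where u: "u \<in> ?V" "u \<notin> S" using SV by blast
    have V: "w \<in> insert u S" if "w \<in> ?V" for w using one[of w u] that u by auto
    have even: "even (card (occ u))"
      using resolve_odd[OF r u(2)] maximal[of "insert u S"] u SV by auto
    obtain t where t: "t \<in> occ u" using u by (auto simp: occ_def)
    have odd: "odd (card (occ u - {t}))" 
      using even card_Suc_Diff1[OF finite_occ t] by (metis even_Suc)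
    have p: "c \<circ> \<sigma> permutes X" "cyclic_on (c \<circ> \<sigma>) X"
      using resolves_step_permutes[OF r] r by (auto simp: resolves_def)
    obtain \<rho> where \<rho>: "\<rho> permutes occ u - {t}" "cyclic_on \<rho> (occ u - {t})" "cyclic_on (c \<circ> \<sigma> \<circ> \<rho>) X"
      using odd_cycle_preserves_cyclic[OF p(1) finite_X p(2) subset_trans[OF Diff_subset occ_subset] odd]
      by blast
    obtain s where s: "s \<in> occ u - {t}" using cyclic_on_nonempty[OF \<rho>(2)] by blast
    have \<rho>X: "\<rho> permutes X"
      using permutes_subset[OF \<rho>(1) subset_trans[OF Diff_subset occ_subset]] .
    let ?\<sigma> = "\<sigma> \<circ> \<rho> \<circ> transpose s t"
    have stX: "s \<in> X" "t \<in> X" and clst: "cl s = u" "cl t = u" using s t by (auto simp: occ_def)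
    have \<sigma>: "\<sigma> permutes X" using r by (simp add: resolves_def)
    have q: "permutation (c \<circ> \<sigma> \<circ> \<rho>)"
      using permutes_imp_permutation[OF finite_X permutes_compose[OF \<rho>X p(1)]] .
    have "s \<noteq> t" using s by blast
    from cyclic_on_split_pair[OF q \<rho>(3) stX this]
    obtain A B where "A \<inter> B = {}" and AB: "A \<union> B = X" and "s \<in> A" "t \<in> B"
      and cyc: "cyclic_on (c \<circ> \<sigma> \<circ> \<rho> \<circ> transpose s t) A"
        "cyclic_on (c \<circ> \<sigma> \<circ> \<rho> \<circ> transpose s t) B" .
    have off: "?\<sigma> a = \<sigma> a" if "cl a \<noteq> u" for a
      using that clst permutes_not_in[OF \<rho>(1), of a] by (auto simp: transpose_def occ_def)
    have "cyclic_on (\<rho> \<circ> transpose s t) (insert t (occ u - {t}))"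
      using s by (intro cyclic_on_insert_right \<rho>(2)) (auto simp: permutes_not_in[OF \<rho>(1)])
    then have cyc': "cyclic_on (\<rho> \<circ> transpose s t) (occ u)" using t by (simp add: insert_absorb)
    have on: "?\<sigma> a = (\<rho> \<circ> transpose s t) a" if "a \<in> occ u" for a
      using cyclic_on_inI[OF cyc' that] r u(2) by (auto simp: resolves_def occ_def)
    have cycu: "cyclic_on ?\<sigma> (occ u)" using cyc' on by (rule cyclic_on_congI)
    show ?thesis
    proof (rule that[of ?\<sigma> A B])
      show "?\<sigma> permutes X"
        using permutes_compose[OF \<rho>X \<sigma>] by (rule permutes_comp_transpose) (use stX in auto)
      show "cl (?\<sigma> a) = cl a" if "a \<in> X" for a
      proof (cases "cl a = u")
        case True
        then show ?thesis using cyclic_on_inI[OF cycu, of a] that by (simp add: occ_def)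
      next
        case False
        then show ?thesis using off[OF False] resolves_class[OF r that] by simp
      qed
      show "cyclic_on ?\<sigma> (occ v)" if v: "v \<in> ?V" for v
      proof (cases "v = u")
        case False
        then have "cyclic_on \<sigma> (occ v)" using V[OF v] r by (auto simp: resolves_def)
        then show ?thesis by (rule cyclic_on_congI) (use off False in \<open>simp add: occ_def\<close>)
      qed (use cycu in simp)
      show "A \<union> B = X" "cyclic_on (c \<circ> ?\<sigma>) A" "cyclic_on (c \<circ> ?\<sigma>) B"
        using AB cyc by (simp_all only: comp_assoc)
    qed
  qed
qed

end

section \<open>Parity of the number of faces\<close>

lemma orbits_eq_partition:
  assumes "\<Union>P = X" "\<And>C. C \<in> P \<Longrightarrow> cyclic_on p C"
  shows "orbit p ` X = P"
proof (intro equalityI subsetI)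
  fix D assume "D \<in> orbit p ` X"
  then obtain x C where "D = orbit p x" "x \<in> C" "C \<in> P" using assms(1) by blast
  then show "D \<in> P" using orbit_cyclic_eq3[OF assms(2)] by simp
next
  fix C assume C: "C \<in> P"
  then obtain x where "x \<in> C" using cyclic_on_nonempty[OF assms(2)] by blast
  then have "orbit p x = C" "x \<in> X" using orbit_cyclic_eq3[OF assms(2)] C assms(1) by auto
  then show "C \<in> orbit p ` X" by blast
qed

text \<open>The orbits of \<open>a\<close> and \<open>b\<close> become one orbit and every other
  orbit is kept.\<close>

lemma Suc_card_orbits_merge:
  assumes p: "p permutes X" "finite X" and ab: "a \<in> X" "b \<in> X" "b \<notin> orbit p a"
  shows "Suc (card (orbit (p \<circ> transpose a b) ` X)) = card (orbit p ` X)"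
proof -
  have pp: "permutation p" using p permutes_imp_permutation by blast
  note cyc = cyclic_on_orbit'[OF pp]
  let ?O = "orbit p ` X" and ?A = "orbit p a" and ?B = "orbit p b"
  let ?P = "insert (?A \<union> ?B) (?O - {?A, ?B})"
  have self: "x \<in> orbit p x" for x using permutation_self_in_orbit[OF pp] .
  have eq: "orbit p x = orbit p y" if "y \<in> orbit p x" for x y
    using orbit_cyclic_eq3[OF cyc that] by simp
  have AB: "?A \<noteq> ?B" using ab self by blast
  have disj: "?A \<inter> ?B = {}" using eq AB by blast
  have un: "\<Union>?O = X" using permutes_orbit_subset[OF p(1)] self by blast
  have "orbit (p \<circ> transpose a b) ` X = ?P"
  proof (rule orbits_eq_partition)
    show "\<Union>?P = X" using un ab by blast
    fix C assume C: "C \<in> ?P"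
    show "cyclic_on (p \<circ> transpose a b) C"
    proof (cases "C = ?A \<union> ?B")
      case True
      then show ?thesis using cyclic_on_merge[OF cyc cyc disj self self] by simp
    next
      case False
      then obtain x where x: "C = orbit p x" "C \<noteq> ?A" "C \<noteq> ?B" using C by blast
      then have "a \<notin> C" "b \<notin> C" using eq by blast+
      then show ?thesis using cyclic_on_transpose_outside[OF cyc] x by blast
    qed
  qed
  moreover have "?A \<union> ?B \<notin> ?O - {?A, ?B}"
  proof
    assume "?A \<union> ?B \<in> ?O - {?A, ?B}"
    then obtain x where "orbit p x = ?A \<union> ?B" "orbit p x \<noteq> ?A" by auto
    then show False using eq self by blast
  qed
  moreover have "card (?O - {?A, ?B}) = card ?O - 2"
    using ab AB p by (subst card_Diff_subset) auto
  moreover have "2 \<le> card ?O"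
    using card_mono[of ?O "{?A, ?B}"] ab AB p by auto
  ultimately show ?thesis using p by simp
qed

text \<open>Each transposition changes the sign and, by a merge or a split, also the parity of the
  number of orbits, fixed points included.\<close>

lemma evenperm_iff_card_orbits:
  assumes "p permutes X" "finite X"
  shows "evenperm p \<longleftrightarrow> even (card X + card (orbit p ` X))"
  using assms(2,1)
proof (induct p rule: permutes_rev_induct)
  case id
  have "orbit id x = {x}" for x :: 'a by (simp only: orbit_eq_singleton_iff id_apply)
  then have "card (orbit id ` X) = card X" by (simp add: card_image cong: image_cong)
  then show ?case by (simp only: evenperm_id even_add simp_thms)
next
  case (swap a b p)
  let ?q = "p \<circ> transpose a b"
  have pp: "permutation p" using swap assms permutes_imp_permutation by blast
  have "evenperm ?q \<longleftrightarrow> \<not> evenperm p"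
    using evenperm_comp[OF pp permutation_swap_id, of a b] evenperm_swap[of a b] \<open>a \<noteq> b\<close> by simp
  moreover have "Suc (card (orbit ?q ` X)) = card (orbit p ` X) \<or> Suc (card (orbit p ` X)) = card (orbit ?q ` X)"
  proof (cases "b \<in> orbit p a")
    case False
    then show ?thesis using Suc_card_orbits_merge[OF \<open>p permutes X\<close> assms(2)] swap by blast
  next
    case True
    have q: "?q permutes X" using permutes_comp_transpose[OF \<open>p permutes X\<close> subset_refl] swap by blast
    from cyclic_on_split_pair[OF pp cyclic_on_orbit'[OF pp] permutation_self_in_orbit[OF pp] True \<open>a \<noteq> b\<close>]
    obtain B C where BC: "B \<inter> C = {}" "B \<union> C = orbit p a" "a \<in> B" "b \<in> C" "cyclic_on ?q B" "cyclic_on ?q C" .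
    have "b \<notin> orbit ?q a" using orbit_cyclic_eq3[OF BC(5,3)] BC by blast
    \<comment> \<open>A split is a merge undone: the same transposition leads from \<open>?q\<close>
      back to \<open>p\<close>.\<close>
    then have "Suc (card (orbit (?q \<circ> transpose a b) ` X)) = card (orbit ?q ` X)"
      using Suc_card_orbits_merge[OF q assms(2)] swap by blast
    then show ?thesis by (simp add: comp_assoc)
  qed
  then have "even (card (orbit ?q ` X)) \<longleftrightarrow> odd (card (orbit p ` X))" by (metis even_Suc)
  ultimately show ?case
    using \<open>evenperm p \<longleftrightarrow> even (card X + card (orbit p ` X))\<close> unfolding even_add by blast
qed

lemma (in multigraph) card_arcs: "card (arcs G) = 2 * card (edges G arev)"
proof -
  have "2 * card (edges G arev) = card (\<Union>(edges G arev))"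
  proof (rule card_partition)
    show "finite (edges G arev)" "finite (\<Union>(edges G arev))"
      by (auto simp: edges_def)
    show "card e = 2" if "e \<in> edges G arev" for e
      using that arev_neq by (force simp: edges_def)
    show "e \<inter> e' = {}" if "e \<in> edges G arev" "e' \<in> edges G arev" "e \<noteq> e'" for e e'
      using that by (auto simp: edges_def arev_eq_iff)
  qed
  moreover have "\<Union>(edges G arev) = arcs G" by (auto simp: edges_def)
  ultimately show ?thesis by simp
qed

text \<open>The orbits of \<open>rot\<close>, \<open>arev\<close> and
  \<open>rot \<circ> arev\<close> are the vertices, edges and faces. Multiplicativity of the sign
  relates the three parities, the number of darts being even.\<close>

lemma (in multigraph) euler_char_parity:
  assumes emb: "orientable_embedding G rot" and out: "\<And>v. v \<in> verts G \<Longrightarrow> out_arcs G v \<noteq> {}"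
  shows "even (card (verts G) + card (edges G arev) + card (faces G arev rot))"
proof -
  have rot: "rot permutes arcs G" "\<And>v. v \<in> verts G \<Longrightarrow> cyclic_on rot (out_arcs G v)"
    using emb out by (auto simp: orientable_embedding_def)
  have "orbit rot ` arcs G = out_arcs G ` verts G"
    by (rule orbits_eq_partition) (use rot in \<open>auto simp: tail_in_verts\<close>)
  moreover have "inj_on (out_arcs G) (verts G)" using out by (fastforce simp: inj_on_def)
  ultimately have 1: "evenperm rot \<longleftrightarrow> even (card (arcs G) + card (verts G))"
    using evenperm_iff_card_orbits[OF rot(1) finite_arcs] by (simp add: card_image)
  have "orbit arev a = {a, arev a}" for a
  proof (intro equalityI subsetI)
    fix b assume "b \<in> orbit arev a"
    then show "b \<in> {a, arev a}" by induct auto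
  next
    fix b assume "b \<in> {a, arev a}"
    then show "b \<in> orbit arev a" using orbit.base[of arev a] orbit.step[of "arev a" arev a] by auto
  qed
  then have 2: "evenperm arev \<longleftrightarrow> even (card (arcs G) + card (edges G arev))"
    using evenperm_iff_card_orbits[OF arev_permutes_arcs finite_arcs] by (simp add: edges_def)
  have 3: "evenperm (rot \<circ> arev) \<longleftrightarrow> even (card (arcs G) + card (faces G arev rot))"
    using evenperm_iff_card_orbits[OF permutes_compose[OF arev_permutes_arcs rot(1)] finite_arcs]
    by (simp add: faces_def face_of_def[abs_def] face_step_def)
  have "evenperm (rot \<circ> arev) \<longleftrightarrow> evenperm rot = evenperm arev"
    using evenperm_comp permutes_imp_permutation[OF finite_arcs] rot(1) arev_permutes_arcs by blast
  then show ?thesis using 1 2 3 by (auto simp: card_arcs)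
qed

section \<open>The embedding determined by an euler circuit\<close>

lemma cyclic_on_enumeration:
  assumes "cyclic_on p A"
  obtains q where "q \<noteq> []" "distinct q" "set q = A"
    "\<And>i. i < length q \<Longrightarrow> q ! (Suc i mod length q) = p (q ! i)"
proof -
  obtain x where x: "x \<in> A" "orbit p x = A" using assms by (auto simp: cyclic_on_def)
  define n where "n = funpow_dist1 p x x"
  let ?q = "map (\<lambda>i. (p ^^ i) x) [0..<n]"
  have xo: "x \<in> orbit p x" using x by simp
  have n: "n > 0" by (simp add: n_def)
  have pn: "(p ^^ n) x = x" unfolding n_def using funpow_dist1_prop[OF xo] .
  show ?thesis
  proof
    show "?q \<noteq> []" using n by simp
    have "inj_on (\<lambda>i. (p ^^ i) x) {0..<n}" unfolding n_def by (rule inj_on_funpow_dist1[OF xo])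
    then show "distinct ?q" by (simp add: distinct_map)
    have "orbit p x = (\<lambda>i. (p ^^ i) x) ` {0..<n}"
      unfolding n_def by (rule orbit_conv_funpow_dist1[OF xo])
    then show "set ?q = A" using x by simp
    fix i assume i: "i < length ?q"
    show "?q ! (Suc i mod length ?q) = p (?q ! i)"
    proof (cases "Suc i = n")
      case True
      then show ?thesis using pn n i by auto
    next
      case False
      then show ?thesis using i by simp
    qed
  qed
qed

lemma cyclic_successor:
  assumes T: "distinct T" "T \<noteq> []"
  obtains c where "c permutes set T" "cyclic_on c (set T)"
    "\<And>i. i < length T \<Longrightarrow> T ! (Suc i mod length T) = c (T ! i)"
proof -
  let ?n = "length T"
  define c where "c a = (if a \<in> set T then T ! (Suc (inv_into {..<?n} ((!) T) a) mod ?n) else a)" for a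
  have inj: "inj_on ((!) T) {..<?n}" using T by (simp add: inj_on_nth)
  have step: "c (T ! i) = T ! (Suc i mod ?n)" if "i < ?n" for i
    using that inv_into_f_f[OF inj, of i] by (simp add: c_def)
  have "c permutes set T"
  proof (rule inj_imp_permutes)
    show "inj_on c (set T)"
    proof (rule inj_onI)
      fix a b assume "a \<in> set T" "b \<in> set T" and eq: "c a = c b"
      then obtain i j where ij: "i < ?n" "j < ?n" "a = T ! i" "b = T ! j" by (metis in_set_conv_nth)
      then have "T ! (Suc i mod ?n) = T ! (Suc j mod ?n)" using eq step by simp
      then have "Suc i mod ?n = Suc j mod ?n"
        using T ij by (subst (asm) nth_eq_iff_index_eq) auto
      then have "i = j" using ij by (cases "Suc i = ?n"; cases "Suc j = ?n") auto
      then show "a = b" using ij by simp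
    qed
    show "c a \<in> set T" if "a \<in> set T" for a using that T by (simp add: c_def)
  qed (auto simp: c_def)
  moreover have "cyclic_on c (set T)"
  proof (rule cyclic_on_singleI[of "T ! 0"])
    have pow: "(c ^^ i) (T ! 0) = T ! (i mod ?n)" for i
      by (induct i) (use T step in \<open>auto simp: mod_Suc_eq\<close>)
    have "(c ^^ ?n) (T ! 0) = T ! 0" using pow[of ?n] by simp
    then have "orbit c (T ! 0) = {(c ^^ m) (T ! 0) |m. m < ?n}"
      using T by (intro orbit_altdef_bounded) auto
    also have "\<dots> = (\<lambda>m. (c ^^ m) (T ! 0)) ` {..<?n}" by blast
    also have "\<dots> = (\<lambda>m. T ! m) ` {..<?n}" by (rule image_cong) (simp_all add: pow)
    also have "\<dots> = set T" by (auto simp: in_set_conv_nth)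
    finally show "set T = orbit c (T ! 0)" by (rule sym)
  qed (use T in simp)
  ultimately show ?thesis using that step by simp
qed

section \<open>Closed walks as lists of arcs\<close>

lemma all_nat_split: "(\<forall>i. P i) \<longleftrightarrow> P 0 \<and> (\<forall>i. P (Suc i))"
  by (metis not0_implies_Suc)

lemma (in pre_digraph) cas_iff_nth:
  assumes "p \<noteq> []"
  shows "cas u p v \<longleftrightarrow> tail G (hd p) = u \<and> head G (last p) = v \<and>
    (\<forall>i. Suc i < length p \<longrightarrow> tail G (p ! Suc i) = head G (p ! i))"
  using assms
proof (induct p arbitrary: u)
  case (Cons a p)
  show ?case
  proof (cases "p = []")
    case False
    have "(\<forall>i. Suc i < length (a # p) \<longrightarrow> tail G ((a # p) ! Suc i) = head G ((a # p) ! i)) \<longleftrightarrow>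
      tail G (hd p) = head G a \<and> (\<forall>i. Suc i < length p \<longrightarrow> tail G (p ! Suc i) = head G (p ! i))"
      using False by (subst all_nat_split) (auto simp: hd_conv_nth)
    then show ?thesis using Cons False by auto
  qed auto
qed simp

text \<open>Indices modulo the length treat the closing condition like the others; it is the case of
  the last index.\<close>

lemma (in pre_digraph) closed_cas_iff:
  assumes "p \<noteq> []"
  shows "(\<exists>u. cas u p u) \<longleftrightarrow> (\<forall>i<length p. tail G (p ! (Suc i mod length p)) = head G (p ! i))"
    (is "_ \<longleftrightarrow> ?R")
proof -
  let ?n = "length p"
  have "?R \<longleftrightarrow> tail G (hd p) = head G (last p) \<and>
      (\<forall>i. Suc i < ?n \<longrightarrow> tail G (p ! Suc i) = head G (p ! i))"
  proof
    assume R: ?R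
    have "tail G (p ! (Suc (?n - 1) mod ?n)) = head G (p ! (?n - 1))"
      using R assms by (metis diff_less length_greater_0_conv zero_less_one)
    then have "tail G (hd p) = head G (last p)"
      using assms by (simp add: hd_conv_nth last_conv_nth)
    moreover have "tail G (p ! Suc i) = head G (p ! i)" if "Suc i < ?n" for i
      using R[rule_format, of i] that by simp
    ultimately show "tail G (hd p) = head G (last p) \<and>
      (\<forall>i. Suc i < ?n \<longrightarrow> tail G (p ! Suc i) = head G (p ! i))" by blast
  next
    assume L: "tail G (hd p) = head G (last p) \<and>
      (\<forall>i. Suc i < ?n \<longrightarrow> tail G (p ! Suc i) = head G (p ! i))"
    show ?R
    proof (intro allI impI)
      fix i assume i: "i < ?n"
      show "tail G (p ! (Suc i mod ?n)) = head G (p ! i)"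
      proof (cases "Suc i = ?n")
        case True
        then have "i = ?n - 1" by simp
        then show ?thesis using True L assms by (simp add: hd_conv_nth last_conv_nth)
      next
        case False
        then show ?thesis using L i by simp
      qed
    qed
  qed
  then show ?thesis using cas_iff_nth[OF assms] by auto
qed

text \<open>An euler circuit in working form: \<open>set T\<close> contains one dart of every edge,
  thus orients the graph, and \<open>c\<close> is the successor along \<open>T\<close>.\<close>

locale euler_tour = multigraph G arev
  for G :: "('a, 'b) pre_digraph" and arev :: "'b \<Rightarrow> 'b" +
  fixes T :: "'b list" and c :: "'b \<Rightarrow> 'b"
  assumes T_distinct: "distinct T" and T_nonempty: "T \<noteq> []" and T_arcs: "set T \<subseteq> arcs G"
    and T_once: "\<And>a. a \<in> arcs G \<Longrightarrow> a \<in> set T \<longleftrightarrow> arev a \<notin> set T"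
    and T_verts: "head G ` set T = verts G"
    and c_permutes: "c permutes set T" and c_cyclic: "cyclic_on c (set T)"
    and c_T: "\<And>i. i < length T \<Longrightarrow> T ! (Suc i mod length T) = c (T ! i)"
    and tail_c: "\<And>a. a \<in> set T \<Longrightarrow> tail G (c a) = head G a"

lemma (in multigraph) euler_tourI:
  assumes T: "euler_circuit G arev T" and ne: "arcs G \<noteq> {}"
  obtains c where "euler_tour G arev T c"
proof -
  have once: "\<exists>!i. i < length T \<and> T ! i \<in> {a, arev a}" if "a \<in> arcs G" for a
    using T that by (simp add: euler_circuit_def edges_def)
  have index_unique: "i = j"
    if "a \<in> arcs G" "i < length T" "T ! i \<in> {a, arev a}" "j < length T" "T ! j \<in> {a, arev a}" for a i j
    using once[OF that(1)] that(2-5) by blast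
  obtain u where u: "awalk u T u" "set (awalk_verts u T) = verts G"
    using T unfolding euler_circuit_def by blast
  have arcs: "set T \<subseteq> arcs G" and cas: "cas u T u" using u(1) by (auto simp: awalk_def)
  obtain a where "a \<in> arcs G" using ne by blast
  from once[OF this] have neT: "T \<noteq> []" by auto
  have dist: "distinct T"
    unfolding distinct_conv_nth
  proof (intro allI impI notI)
    fix i j assume ij: "i < length T" "j < length T" "i \<noteq> j" "T ! i = T ! j"
    have "T ! i \<in> arcs G" using arcs ij(1) by auto
    from index_unique[OF this ij(1) _ ij(2)] show False using ij(3,4) by simp
  qed
  have exactly: "a \<in> set T \<longleftrightarrow> arev a \<notin> set T" if a: "a \<in> arcs G" for a
  proof
    assume "a \<in> set T"
    then obtain i where i: "i < length T" "T ! i = a" by (auto simp: in_set_conv_nth)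
    show "arev a \<notin> set T"
    proof
      assume "arev a \<in> set T"
      then obtain j where j: "j < length T" "T ! j = arev a" by (auto simp: in_set_conv_nth)
      have "i = j" using index_unique[OF a i(1) _ j(1)] i(2) j(2) by simp
      then show False using i j arev_neq[OF a] by simp
    qed
  next
    assume no: "arev a \<notin> set T"
    obtain i where i: "i < length T" "T ! i \<in> {a, arev a}" using once[OF a] by blast
    have "T ! i \<in> set T" using i(1) by simp
    moreover from this have "T ! i \<noteq> arev a" using no by metis
    ultimately show "a \<in> set T" using i(2) by (metis insertE singletonD)
  qed
  obtain c where c: "c permutes set T" "cyclic_on c (set T)"
    "\<And>i. i < length T \<Longrightarrow> T ! (Suc i mod length T) = c (T ! i)"
    using cyclic_successor[OF dist neT] by blast
  have tail: "tail G (c a) = head G a" if "a \<in> set T" for a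
  proof -
    obtain i where i: "i < length T" "a = T ! i" using \<open>a \<in> set T\<close> by (metis in_set_conv_nth)
    have "\<forall>i<length T. tail G (T ! (Suc i mod length T)) = head G (T ! i)"
      using cas closed_cas_iff[OF neT] by blast
    then show ?thesis using i c(3) by simp
  qed
  have "tail G ` set T = head G ` set T"
  proof -
    have "tail G ` set T = tail G ` (c ` set T)" using permutes_image[OF c(1)] by simp
    also have "\<dots> = head G ` set T" using tail by (simp add: image_image cong: image_cong)
    finally show ?thesis .
  qed
  then have verts: "head G ` set T = verts G" using u set_awalk_verts_not_Nil[OF u(1) neT] by simp
  have "euler_tour G arev T c"
    by unfold_locales (fact dist neT arcs exactly verts c tail)+
  then show ?thesis by (rule that)
qed

section \<open>The rotation determined by a tour\<close>

context euler_tour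
begin

text \<open>A passage of \<open>T\<close> through a vertex is represented by the arc on which
  \<open>T\<close> arrives, hence the classification by heads.\<close>

sublocale cyclic_word "set T" c "head G"
  by unfold_locales (simp_all add: c_permutes c_cyclic)

lemma arcs_eq: "arcs G = set T \<union> arev ` set T"
proof (intro equalityI subsetI)
  fix a assume "a \<in> arcs G"
  then have "a \<in> set T \<or> arev a \<in> set T" using T_once[of a] by blast
  then show "a \<in> set T \<union> arev ` set T" using image_eqI[of a arev "arev a"] by auto
qed (use T_arcs in auto)

lemma arev_notin: "a \<in> set T \<Longrightarrow> arev a \<notin> set T"
  using T_once[of a] subsetD[OF T_arcs, of a] by blast

lemma tail_T:
  assumes "b \<in> set T"
  obtains a where "a \<in> set T" "b = c a" "head G a = tail G b"
proof -
  have "b \<in> c ` set T" using permutes_image[OF c_permutes] assms by simp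
  then obtain a where a: "a \<in> set T" "b = c a" by blast
  then have "head G a = tail G b" using tail_c[OF a(1)] by simp
  with a show ?thesis by (rule that)
qed

lemma out_arcs_nonempty:
  assumes "v \<in> verts G"
  shows "out_arcs G v \<noteq> {}"
proof -
  have "v \<in> head G ` set T" using assms T_verts by simp
  then obtain a where a: "a \<in> set T" "v = head G a" by blast
  then have "a \<in> arcs G" using T_arcs by blast
  then have "arev a \<in> out_arcs G v" using a by simp
  then show ?thesis by blast
qed

text \<open>\<open>T\<close> traverses every edge in one direction, and that arc and its predecessor
  along \<open>T\<close> have the two ends of the edge as heads.\<close>

lemma min_degree_le_nbrs:
  assumes v: "v \<in> verts G"
  shows "min_degree (underlying_simple G) \<le> card (nbrs v)"
proof -
  have "snd ` out_arcs (underlying_simple G) v \<subseteq> nbrs v"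
  proof
    fix w assume "w \<in> snd ` out_arcs (underlying_simple G) v"
    then have vw: "v \<noteq> w" "v \<rightarrow>\<^bsub>G\<^esub> w" by (auto simp: underlying_simple_def)
    from vw(2) obtain b where b: "b \<in> arcs G" "tail G b = v" "head G b = w" by (rule reachableE)
    show "w \<in> nbrs v"
    proof (cases "b \<in> set T")
      case True
      obtain a where "a \<in> set T" "b = c a" "head G a = tail G b" using tail_T[OF True] .
      then show ?thesis using b vw(1) unfolding nbrs_def by blast
    next
      case False
      then have r: "arev b \<in> set T" using T_once[of b] b by blast
      have "tail G (arev b) = w" "head G (arev b) = v" using b by auto
      moreover obtain a where "a \<in> set T" "arev b = c a" "head G a = tail G (arev b)"
        using tail_T[OF r] .
      ultimately show ?thesis using vw(1) unfolding nbrs_def by auto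
    qed
  qed
  moreover have "inj_on snd (out_arcs (underlying_simple G) v)"
    by (auto simp: inj_on_def underlying_simple_def)
  ultimately have "out_degree (underlying_simple G) v \<le> card (nbrs v)"
    unfolding out_degree_def using card_mono[OF finite_nbrs] card_image by metis
  moreover have "min_degree (underlying_simple G) \<le> out_degree (underlying_simple G) v"
    unfolding min_degree_def using v by (intro Min_le) (auto simp: underlying_simple_def)
  ultimately show ?thesis by linarith
qed

text \<open>The rotation that makes \<open>T\<close> a face and continues the other faces along the reverse
  of \<open>\<pi>\<close>.\<close>

definition tour_rot :: "('b \<Rightarrow> 'b) \<Rightarrow> 'b \<Rightarrow> 'b" where
  "tour_rot \<pi> d = (if d \<in> set T then arev (inv \<pi> d) else if d \<in> arcs G then c (arev d) else d)"

text \<open>At a vertex the rotation alternates: \<open>arev a\<close> is followed by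
  \<open>c a\<close>, and \<open>c a\<close> by \<open>arev (inv \<sigma> a)\<close>. Two steps thus
  follow \<open>inv \<sigma>\<close>, which is cyclic on \<open>occ v\<close>, and the arcs leaving
  along \<open>T\<close> are met in between.\<close>

lemma tour_rot_embedding:
  assumes \<sigma>: "\<sigma> permutes set T" "\<And>a. a \<in> set T \<Longrightarrow> head G (\<sigma> a) = head G a"
    "\<And>v. v \<in> verts G \<Longrightarrow> cyclic_on \<sigma> (occ v)"
  shows "orientable_embedding G (tour_rot (c \<circ> \<sigma>))"
proof -
  let ?\<pi> = "c \<circ> \<sigma>"
  let ?rot = "tour_rot ?\<pi>"
  have \<pi>: "?\<pi> permutes set T" using \<sigma>(1) c_permutes by (rule permutes_compose)
  have inv\<pi>: "inv ?\<pi> d \<in> set T" if "d \<in> set T" for d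
    using permutes_in_image[OF permutes_inv[OF \<pi>]] that by blast
  have rot_T: "?rot d = arev (inv ?\<pi> d)" if "d \<in> set T" for d using that by (simp add: tour_rot_def)
  have rot_rev: "?rot (arev a) = c a" if "a \<in> set T" for a
    using that arev_notin[OF that] subsetD[OF T_arcs that] by (simp add: tour_rot_def)
  have c_in: "c a \<in> set T" if "a \<in> set T" for a using permutes_in_image[OF c_permutes] that by blast
  have rot: "?rot permutes arcs G"
  proof (rule inj_imp_permutes)
    show "finite (arcs G)" by simp
    show "?rot d \<in> arcs G" if "d \<in> arcs G" for d
      using that rot_T rot_rev inv\<pi> c_in unfolding arcs_eq by auto
    show "?rot d = d" if "d \<notin> arcs G" for d using that T_arcs by (auto simp: tour_rot_def)
    show "inj_on ?rot (arcs G)"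
    proof (rule inj_onI)
      fix d d' assume d: "d \<in> arcs G" "d' \<in> arcs G" "?rot d = ?rot d'"
      have injc: "inj c" and inji: "inj (inv ?\<pi>)"
        using permutes_inj[OF c_permutes] permutes_inj[OF permutes_inv[OF \<pi>]] by auto
      \<comment> \<open>The rotation sends arcs of \<open>T\<close> to reversed arcs and reversed
        arcs to arcs of \<open>T\<close>, so the mixed cases cannot occur.\<close>
      consider "d \<in> set T" "d' \<in> set T" | "d \<in> set T" "d' \<notin> set T" | "d \<notin> set T" "d' \<in> set T"
        | "d \<notin> set T" "d' \<notin> set T" by blast
      then show "d = d'"
      proof cases
        case 1
        then show ?thesis using d(3) rot_T inji by (simp add: arev_eq_iff inj_eq)
      next
        case 2
        then have "arev d' \<in> set T" using T_once[of d'] d by blast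
        then have "?rot d' \<in> set T" using rot_rev[of "arev d'"] c_in by simp
        then show ?thesis using d(3) rot_T[OF 2(1)] arev_notin[OF inv\<pi>[OF 2(1)]] by simp
      next
        case 3
        then have "arev d \<in> set T" using T_once[of d] d by blast
        then have "?rot d \<in> set T" using rot_rev[of "arev d"] c_in by simp
        then show ?thesis using d(3) rot_T[OF 3(2)] arev_notin[OF inv\<pi>[OF 3(2)]] by simp
      next
        case 4
        then have "arev d \<in> set T" "arev d' \<in> set T" using T_once[of d] T_once[of d'] d by blast+
        then have "c (arev d) = c (arev d')" using d(3) rot_rev[of "arev d"] rot_rev[of "arev d'"] by simp
        then show ?thesis using injc by (simp add: inj_eq arev_eq_iff)
      qed
    qed
  qed
  have permrot: "permutation ?rot" using rot permutes_imp_permutation[OF finite_arcs] by blast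
  have "cyclic_on ?rot (out_arcs G v)" if v: "v \<in> verts G" for v
  proof -
    have "v \<in> head G ` set T" using v T_verts by simp
    then obtain a0 where a0: "a0 \<in> occ v" unfolding occ_def by blast
    let ?O = "orbit ?rot (arev a0)"
    have two: "?rot (?rot (arev a)) = arev (inv \<sigma> a)" if a: "a \<in> set T" for a
    proof -
      have "?\<pi> (inv \<sigma> a) = c a" using permutes_inverses(1)[OF \<sigma>(1)] by simp
      then have "inv ?\<pi> (c a) = inv \<sigma> a" using permutes_inv_eq[OF \<pi>] by metis
      then show ?thesis using rot_rev[OF a] rot_T[OF c_in[OF a]] by simp
    qed
    have "cyclic_on (inv \<sigma>) (occ v)"
      using \<sigma>(3)[OF v] orbit_inv_eq[OF permutes_imp_permutation[OF finite_set \<sigma>(1)]]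
      by (simp add: cyclic_on_def)
    then have sub: "occ v \<subseteq> {a. arev a \<in> ?O}"
    proof (rule cyclic_on_subset_of_closed[OF _ a0])
      show "a0 \<in> {a. arev a \<in> ?O}" using permutation_self_in_orbit[OF permrot] by simp
      fix z assume z: "z \<in> occ v" "z \<in> {a. arev a \<in> ?O}"
      then have "?rot (?rot (arev z)) \<in> ?O" by (auto intro: orbit.step)
      then show "inv \<sigma> z \<in> {a. arev a \<in> ?O}" using two z by (simp add: occ_def)
    qed
    have "out_arcs G v \<subseteq> ?O"
    proof
      fix b assume b: "b \<in> out_arcs G v"
      show "b \<in> ?O"
      proof (cases "b \<in> set T")
        case True
        obtain a where a: "a \<in> set T" "b = c a" "head G a = tail G b" using tail_T[OF True] .
        then have "arev a \<in> ?O" using sub b by (auto simp: occ_def)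
        then show ?thesis using orbit.step[of "arev a" ?rot] rot_rev a by metis
      next
        case False
        then have "arev b \<in> occ v" using T_once[of b] b by (auto simp: occ_def)
        then show ?thesis using sub by auto
      qed
    qed
    moreover have "?O \<subseteq> out_arcs G v"
    proof
      have closed: "?rot b \<in> out_arcs G v" if b: "b \<in> out_arcs G v" for b
      proof (cases "b \<in> set T")
        case True
        obtain a where a: "a \<in> set T" "b = c a" "head G a = tail G b" using tail_T[OF True] .
        have i: "inv \<sigma> a \<in> set T" using permutes_in_image[OF permutes_inv[OF \<sigma>(1)]] a by blast
        have "head G (inv \<sigma> a) = head G a"
          using \<sigma>(2)[OF i] permutes_inverses(1)[OF \<sigma>(1)] by simp
        moreover have "?rot b = arev (inv \<sigma> a)" using two[OF a(1)] rot_rev[OF a(1)] a by simp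
        ultimately show ?thesis using a b i T_arcs by auto
      next
        case False
        then have r: "arev b \<in> set T" using T_once[of b] b by auto
        then have "?rot b = c (arev b)" using rot_rev[OF r] by simp
        then show ?thesis using tail_c[OF r] b c_in[OF r] T_arcs by auto
      qed
      fix b assume "b \<in> ?O"
      then show "b \<in> out_arcs G v"
      proof induct
        case base
        show ?case by (rule closed) (use a0 T_arcs in \<open>auto simp: occ_def\<close>)
      qed (rule closed)
    qed
    ultimately have "out_arcs G v = ?O" by blast
    moreover have "arev a0 \<in> ?O" using permutation_self_in_orbit[OF permrot] .
    ultimately show ?thesis unfolding cyclic_on_def by blast
  qed
  then show ?thesis using rot by (simp add: orientable_embedding_def)
qed

section \<open>Faces of the rotation built from the tour\<close>

context
  fixes \<pi> assumes \<pi>: "\<pi> permutes set T"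
begin

lemma face_step_T: "a \<in> set T \<Longrightarrow> face_step arev (tour_rot \<pi>) a = c a"
  using arev_notin[of a] subsetD[OF T_arcs, of a] by (simp add: face_step_def tour_rot_def)

lemma face_step_arev: "a \<in> set T \<Longrightarrow> face_step arev (tour_rot \<pi>) (arev a) = arev (inv \<pi> a)"
  by (simp add: face_step_def tour_rot_def)

lemma face_of_T:
  assumes a: "a \<in> set T"
  shows "face_of arev (tour_rot \<pi>) a = set T"
proof -
  have "orbit c a = orbit (face_step arev (tour_rot \<pi>)) a"
    by (rule orbit_cong0[OF a]) (simp_all add: permutes_in_image[OF c_permutes] face_step_T)
  then show ?thesis using orbit_cyclic_eq3[OF c_cyclic a] by (simp add: face_of_def)
qed

text \<open>On reversed arcs the face step is \<open>inv \<pi>\<close> conjugated by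
  \<open>arev\<close>, and a permutation has the same orbits as its inverse.\<close>

lemma face_of_arev:
  assumes a: "a \<in> set T"
  shows "face_of arev (tour_rot \<pi>) (arev a) = arev ` orbit \<pi> a"
proof -
  have p: "permutation \<pi>" using permutes_imp_permutation[OF finite_set \<pi>] .
  have i: "inv \<pi> permutes set T" using permutes_inv[OF \<pi>] .
  have "arev ` orbit (inv \<pi>) a = orbit (face_step arev (tour_rot \<pi>)) (arev a)"
  proof (rule orbit_inverse)
    show "a \<in> orbit (inv \<pi>) a" using permutation_self_in_orbit[OF permutation_inverse[OF p]] .
    fix x assume "x \<in> orbit (inv \<pi>) a"
    then have "x \<in> set T" using permutes_orbit_subset[OF i a] by blast
    then show "face_step arev (tour_rot \<pi>) (arev x) = arev (inv \<pi> x)" by (rule face_step_arev)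
  qed
  then show ?thesis by (simp add: face_of_def orbit_inv_eq[OF p])
qed

lemma faces_tour_rot: "faces G arev (tour_rot \<pi>) = insert (set T) ((\<lambda>a. arev ` orbit \<pi> a) ` set T)"
proof -
  have "face_of arev (tour_rot \<pi>) ` set T = (\<lambda>a. set T) ` set T"
    by (rule image_cong) (simp_all add: face_of_T)
  also have "\<dots> = {set T}" using T_nonempty by (simp add: image_constant_conv)
  finally show ?thesis
    by (simp add: faces_def arcs_eq image_Un image_image face_of_arev cong: image_cong)
qed

lemma arev_orbit_neq: "a \<in> set T \<Longrightarrow> arev ` orbit \<pi> a \<noteq> set T"
proof
  assume a: "a \<in> set T" and eq: "arev ` orbit \<pi> a = set T"
  have "\<pi> a \<in> set T" using permutes_in_image[OF \<pi>] a by simp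
  moreover have "arev (\<pi> a) \<in> set T" using eq orbit.base[of \<pi> a] by blast
  ultimately show False using arev_notin[of "\<pi> a"] by blast
qed

lemma tour_rot_coloring: "proper_2_face_coloring G arev (tour_rot \<pi>) (\<lambda>F. F = set T)"
  unfolding proper_2_face_coloring_def
proof
  fix a assume "a \<in> arcs G"
  then show "(face_of arev (tour_rot \<pi>) a = set T) \<noteq> (face_of arev (tour_rot \<pi>) (arev a) = set T)"
    unfolding arcs_eq
  proof
    assume a: "a \<in> set T"
    then show ?thesis using face_of_T[OF a] face_of_arev[OF a] arev_orbit_neq[OF a] by simp
  next
    assume "a \<in> arev ` set T"
    then obtain b where b: "b \<in> set T" "a = arev b" by blast
    then show ?thesis using face_of_T[OF b(1)] face_of_arev[OF b(1)] arev_orbit_neq[OF b(1)] by simp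
  qed
qed

lemma facial_walk_T: "facial_walk arev (tour_rot \<pi>) (set T) T"
  using T_distinct c_T face_step_T by (simp add: facial_walk_def traces_def)

text \<open>The face is traced against \<open>\<pi>\<close>, so its walk is the reverse of an enumeration along
  \<open>\<pi>\<close>.\<close>

lemma facial_walk_single:
  assumes cyc: "cyclic_on \<pi> (set T)" and tail: "\<And>a. a \<in> set T \<Longrightarrow> tail G (\<pi> a) = head G a"
  shows "\<exists>p. facial_walk arev (tour_rot \<pi>) (arev ` set T) p \<and> euler_circuit G arev p"
proof -
  obtain q where q: "q \<noteq> []" "distinct q" "set q = set T"
    "\<And>i. i < length q \<Longrightarrow> q ! (Suc i mod length q) = \<pi> (q ! i)"
    by (rule cyclic_on_enumeration[OF cyc]) (rule that)
  let ?n = "length q" and ?r = "rev (map arev q)"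
  have inv_nth: "inv \<pi> (q ! (Suc i mod ?n)) = q ! i" if "i < ?n" for i
    using q(4)[OF that] permutes_inverses(2)[OF \<pi>] by simp
  have "traces arev (tour_rot \<pi>) (arev ` set T) ?r"
    unfolding traces_def
  proof (intro conjI allI impI)
    show "distinct ?r" using q(2) by (simp add: distinct_map inj_on_arev)
    show "set ?r = arev ` set T" using q(3) by simp
    fix i assume i: "i < length ?r"
    then have n: "0 < ?n" "?n - Suc i < ?n" by auto
    have "q ! (?n - Suc i) \<in> set T" using n q(3) nth_mem by blast
    then have step: "face_step arev (tour_rot \<pi>) (?r ! i) = arev (inv \<pi> (q ! (?n - Suc i)))"
      using i face_step_arev by (simp add: rev_nth)
    show "?r ! (Suc i mod length ?r) = face_step arev (tour_rot \<pi>) (?r ! i)"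
    \<comment> \<open>Position \<open>i\<close> of \<open>?r\<close> holds the reverse of entry
      \<open>?n - Suc i\<close> of \<open>q\<close>; the wrap-around of \<open>?r\<close> is the
      step from the first entry of \<open>q\<close> back to its last.\<close>
    proof (cases "Suc i = ?n")
      case True
      have "inv \<pi> (q ! (Suc (?n - 1) mod ?n)) = q ! (?n - 1)" by (rule inv_nth) (use n in simp)
      then have "inv \<pi> (q ! 0) = q ! (?n - 1)" using n by simp
      then show ?thesis using step True n by (simp add: rev_nth)
    next
      case False
      then have s: "Suc i < ?n" using i by simp
      have "inv \<pi> (q ! (Suc (?n - Suc (Suc i)) mod ?n)) = q ! (?n - Suc (Suc i))"
        by (rule inv_nth) (use s in simp)
      moreover have "Suc (?n - Suc (Suc i)) mod ?n = ?n - Suc i" using s by (simp add: Suc_diff_Suc)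
      ultimately show ?thesis using step s by (simp add: rev_nth)
    qed
  qed
  \<comment> \<open>The forward walk \<open>q\<close> can serve as the facial walk, since its
    reverse traces the face.\<close>
  moreover have "euler_circuit G arev q"
    unfolding euler_circuit_def
  proof (intro conjI ballI)
    have "\<forall>i<?n. tail G (q ! (Suc i mod ?n)) = head G (q ! i)"
      using q tail nth_mem by metis
    then obtain u where u: "cas u q u" using closed_cas_iff[OF q(1)] by blast
    have vs: "set (awalk_verts u q) = verts G"
      using set_awalk_verts_not_Nil_cas[OF u q(1)] T_verts q(3) T_arcs by auto
    have "awalk u q u" using u vs q(3) T_arcs by (intro awalkI) auto
    then show "\<exists>u. awalk u q u \<and> set (awalk_verts u q) = verts G" using vs by blast
    fix e assume "e \<in> edges G arev"
    then obtain a where a: "a \<in> arcs G" "e = {a, arev a}" by (auto simp: edges_def)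
    have excl: "a \<in> set q \<longleftrightarrow> arev a \<notin> set q" using T_once[OF a(1)] q(3) by simp
    define b where "b = (if a \<in> set q then a else arev a)"
    have b: "b \<in> set q" "b \<in> e" using excl a(2) by (simp_all add: b_def)
    have b_unique: "b' = b" if "b' \<in> set q" "b' \<in> e" for b'
      using that excl a(2) unfolding b_def by (metis insertE singletonD)
    obtain i where i: "i < ?n" "q ! i = b" using b(1) by (metis in_set_conv_nth)
    show "\<exists>!i. i < ?n \<and> q ! i \<in> e"
    proof (rule ex1I[of _ i])
      show "i < ?n \<and> q ! i \<in> e" using i b by simp
      fix j assume j: "j < ?n \<and> q ! j \<in> e"
      then have "q ! j = q ! i" using b_unique[of "q ! j"] i(2) nth_mem by metis
      then show "j = i" using nth_eq_iff_index_eq[OF q(2)] i(1) j by blast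
    qed
  qed
  ultimately show ?thesis unfolding facial_walk_def by blast
qed

end

end

section \<open>Counting faces and comparing genera\<close>

theorem corollary4p5:
  fixes G :: "('a, 'b) pre_digraph" and arev :: "'b \<Rightarrow> 'b" and T :: "'b list" and n :: nat
  assumes "multigraph G arev"
    and "eulerian G"
    and "n = card (verts G)"
    and "real (min_degree (underlying_simple G)) \<ge> (4 * real n + 2) / 5"
    and "euler_circuit G arev T"
  shows "\<exists>rot. orientable_embedding G rot \<and>
    (\<exists>c F\<^sub>T. proper_2_face_coloring G arev rot c \<and>
       {F \<in> faces G arev rot. c F} = {F\<^sub>T} \<and> facial_walk arev rot F\<^sub>T T \<and>
       card {F \<in> faces G arev rot. \<not> c F} =
         (if even (card (verts G) + card (edges G arev)) then 1 else 2)) \<and>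
    (\<forall>rot'. orientable_embedding G rot' \<and> two_face_colorable G arev rot' \<longrightarrow>
       genus G arev rot' \<le> genus G arev rot) \<and>
    (even (card (verts G) + card (edges G arev)) \<longrightarrow>
       bi_eulerian G arev rot \<and>
       (\<exists>F\<in>faces G arev rot. facial_walk arev rot F T) \<and>
       (\<forall>rot'. orientable_embedding G rot' \<longrightarrow> genus G arev rot' \<le> genus G arev rot))"
proof -
  interpret multigraph G arev by fact
  let ?\<delta> = "min_degree (underlying_simple G)" and ?even = "even (card (verts G) + card (edges G arev))"
  have dense: "4 * card (verts G) + 2 \<le> 5 * ?\<delta>"
    using assms(3,4) by (simp add: divide_le_eq)
  \<comment> \<open>Without arcs the minimum degree would be 0, against
    \<open>dense\<close>.\<close>
  have "arcs G \<noteq> {}"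
  proof
    assume no: "arcs G = {}"
    obtain u where "u \<in> verts G" using assms(5) by (auto simp: euler_circuit_def)
    moreover have "out_degree (underlying_simple G) v = 0" for v
      using no by (simp add: out_degree_def out_arcs_def underlying_simple_def arcs_ends_def)
    ultimately have "out_degree (underlying_simple G) ` verts G = {0}" by auto
    then have "?\<delta> = 0" by (simp add: min_degree_def underlying_simple_def)
    then show False using dense by simp
  qed
  with assms(5) obtain c where "euler_tour G arev T c" by (rule euler_tourI)
  then interpret euler_tour G arev T c .
  obtain \<sigma> A B where \<sigma>: "\<sigma> permutes set T" "\<And>a. a \<in> set T \<Longrightarrow> head G (\<sigma> a) = head G a"
      "\<And>v. v \<in> verts G \<Longrightarrow> cyclic_on \<sigma> (occ v)"
    and AB: "A \<union> B = set T" "cyclic_on (c \<circ> \<sigma>) A" "cyclic_on (c \<circ> \<sigma>) B"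
    by (rule dense_two_cycles[of ?\<delta>, unfolded T_verts, OF min_degree_le_nbrs dense]) (assumption, rule that)
  define \<pi> where "\<pi> = c \<circ> \<sigma>"
  define rot where "rot = tour_rot \<pi>"
  have \<pi>: "\<pi> permutes set T" unfolding \<pi>_def using \<sigma>(1) c_permutes by (rule permutes_compose)
  have emb: "orientable_embedding G rot" unfolding rot_def \<pi>_def using \<sigma> by (rule tour_rot_embedding)
  have parity: "?even \<longleftrightarrow> even (card (faces G arev rot'))" if "orientable_embedding G rot'" for rot'
    using euler_char_parity[OF that out_arcs_nonempty] by simp
  let ?N = "{F \<in> faces G arev rot. F \<noteq> set T}"
  have fin: "finite (faces G arev rot')" for rot' by (simp add: faces_def)
  let ?R = "(\<lambda>a. arev ` orbit \<pi> a) ` set T"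
  have faces: "faces G arev rot = insert (set T) ?R" using faces_tour_rot[OF \<pi>] by (simp add: rot_def)
  have "set T \<notin> ?R"
  proof
    assume "set T \<in> ?R"
    then obtain a where "a \<in> set T" "set T = arev ` orbit \<pi> a" by (rule imageE)
    then show False using arev_orbit_neq[OF \<pi>, of a] by simp
  qed
  then have N: "?N = ?R" and T_face: "set T \<in> faces G arev rot" unfolding faces by blast+
  have "orbit \<pi> a \<in> {A, B}" if "a \<in> set T" for a
  proof -
    have "a \<in> A \<or> a \<in> B" using that AB(1) by blast
    then show ?thesis
      using orbit_cyclic_eq3[OF AB(2), of a] orbit_cyclic_eq3[OF AB(3), of a] by (auto simp: \<pi>_def)
  qed
  \<comment> \<open>The faces other than \<open>T\<close> are reversed cycles of
    \<open>\<pi>\<close>, and \<open>A\<close> and \<open>B\<close> cover them all.\<close>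
  then have "?N \<subseteq> {arev ` A, arev ` B}" unfolding N by blast
  then have "card ?N \<le> card {arev ` A, arev ` B}" by (intro card_mono) auto
  also have "\<dots> \<le> 2" by (simp add: card_insert_if)
  finally have N_le: "card ?N \<le> 2" .
  have N_pos: "card ?N > 0" unfolding N using T_nonempty by (simp add: card_gt_0_iff)
  have "card (insert (set T) ?N) = Suc (card ?N)" using fin by (intro card_insert_disjoint) auto
  moreover have "insert (set T) ?N = faces G arev rot" using T_face by blast
  ultimately have card_faces: "card (faces G arev rot) = Suc (card ?N)" by simp
  have "card ?N = 1 \<or> card ?N = 2" using N_le N_pos by linarith
  then have card_N: "card ?N = (if ?even then 1 else 2)"
  proof
    assume "card ?N = 1"
    then show ?thesis using parity[OF emb] card_faces by simp
  next
    assume "card ?N = 2"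
    then show ?thesis using parity[OF emb] card_faces by simp
  qed
  \<comment> \<open>Vertices and edges are the same for all embeddings, so fewer faces mean larger
    genus.\<close>
  have genus: "genus G arev rot' \<le> genus G arev rot"
    if "card (faces G arev rot) \<le> card (faces G arev rot')" for rot'
    using that by (simp add: genus_def euler_char_def divide_right_mono)
  obtain a where a: "a \<in> set T" using T_nonempty by (meson hd_in_set)
  then have a': "a \<in> arcs G" using T_arcs by blast
  \<comment> \<open>The two sides of an edge belong to different faces, so there are at least two
    faces; in the odd case parity raises this to three.\<close>
  have max2: "genus G arev rot' \<le> genus G arev rot"
    if rot': "orientable_embedding G rot'" "two_face_colorable G arev rot'" for rot'
  proof (rule genus)
    have "face_of arev rot' a \<noteq> face_of arev rot' (arev a)"
      using rot'(2) a' by (auto simp: two_face_colorable_def proper_2_face_coloring_def)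
    then have "card {face_of arev rot' a, face_of arev rot' (arev a)} = 2" by simp
    moreover have "{face_of arev rot' a, face_of arev rot' (arev a)} \<subseteq> faces G arev rot'"
      using a' by (simp add: faces_def)
    ultimately have two: "2 \<le> card (faces G arev rot')" using card_mono[OF fin] by metis
    show "card (faces G arev rot) \<le> card (faces G arev rot')"
    proof (cases ?even)
      case True
      then show ?thesis using two card_faces card_N by simp
    next
      case False
      then have "odd (card (faces G arev rot'))" using parity[OF rot'(1)] by blast
      then have "card (faces G arev rot') \<noteq> 2" by auto
      then show ?thesis using two card_faces card_N False by simp
    qed
  qed
  \<comment> \<open>There is at least one face, and parity excludes exactly one.\<close>
  have max: "genus G arev rot' \<le> genus G arev rot" if ev: "?even" "orientable_embedding G rot'" for rot'
  proof (rule genus)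
    have "face_of arev rot' a \<in> faces G arev rot'" using a' by (simp add: faces_def)
    then have "0 < card (faces G arev rot')" using fin[of rot'] by (auto simp: card_gt_0_iff)
    moreover have "card (faces G arev rot') \<noteq> 1" using parity[OF ev(2)] ev(1) by auto
    ultimately have "2 \<le> card (faces G arev rot')" by linarith
    then show "card (faces G arev rot) \<le> card (faces G arev rot')"
      using card_faces card_N ev(1) by simp
  qed
  have bi: "bi_eulerian G arev rot" if ev: "?even"
    unfolding bi_eulerian_def
  proof (intro conjI ballI)
    show "card (faces G arev rot) = 2" using card_faces card_N ev by simp
    have "card ?R = 1" using card_N ev N by simp
    then obtain F' where F': "?R = {F'}" by (rule card_1_singletonE)
    \<comment> \<open>Only one face besides \<open>T\<close> means only one orbit of
      \<open>\<pi>\<close>, because \<open>arev\<close> is injective.\<close>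
    have orbit_T: "orbit \<pi> x = set T" if x: "x \<in> set T" for x
    proof
      show "orbit \<pi> x \<subseteq> set T" using permutes_orbit_subset[OF \<pi> x] .
      show "set T \<subseteq> orbit \<pi> x"
      proof
        fix y assume y: "y \<in> set T"
        have "arev ` orbit \<pi> x \<in> ?R" "arev ` orbit \<pi> y \<in> ?R" using x y by simp_all
        then have "arev ` orbit \<pi> x = arev ` orbit \<pi> y" unfolding F' by simp
        then have "orbit \<pi> x = orbit \<pi> y"
          using inj_image_eq_iff[OF bij_is_inj[OF bij_arev]] by blast
        then show "y \<in> orbit \<pi> x"
          using permutation_self_in_orbit[OF permutes_imp_permutation[OF finite_set \<pi>]] by simp
      qed
    qed
    have cyc: "cyclic_on \<pi> (set T)" using a orbit_T[OF a] by (intro cyclic_on_singleI[of a]) simp_all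
    have tail: "tail G (\<pi> x) = head G x" if "x \<in> set T" for x
      using tail_c[of "\<sigma> x"] \<sigma>(2)[OF that] permutes_in_image[OF \<sigma>(1), of x] that by (simp add: \<pi>_def)
    fix F assume "F \<in> faces G arev rot"
    then consider "F = set T" | "F \<in> ?R" unfolding faces by blast
    then show "\<exists>p. facial_walk arev rot F p \<and> euler_circuit G arev p"
    proof cases
      case 1
      then show ?thesis using facial_walk_T[OF \<pi>] assms(5) unfolding rot_def by blast
    next
      case 2
      then obtain x where "x \<in> set T" "F = arev ` orbit \<pi> x" by (rule imageE)
      then have "F = arev ` set T" using orbit_T by simp
      then show ?thesis using facial_walk_single[OF \<pi> cyc tail] unfolding rot_def by simp
    qed
  qed
  have walk: "facial_walk arev rot (set T) T" using facial_walk_T[OF \<pi>] by (simp add: rot_def)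
  show ?thesis
  proof (intro exI[of _ rot] conjI allI impI)
    show "\<exists>c F\<^sub>T. proper_2_face_coloring G arev rot c \<and>
       {F \<in> faces G arev rot. c F} = {F\<^sub>T} \<and> facial_walk arev rot F\<^sub>T T \<and>
       card {F \<in> faces G arev rot. \<not> c F} = (if ?even then 1 else 2)"
    proof (intro exI[of _ "\<lambda>F. F = set T"] exI[of _ "set T"] conjI)
      show "proper_2_face_coloring G arev rot (\<lambda>F. F = set T)"
        using tour_rot_coloring[OF \<pi>] by (simp add: rot_def)
      show "{F \<in> faces G arev rot. F = set T} = {set T}" using T_face by blast
    qed (fact walk card_N)+
    show "\<exists>F\<in>faces G arev rot. facial_walk arev rot F T" using T_face walk by blast
  qed (use emb max2 max bi in blast)+
qed

end
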